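(* Assume that $P_i\succ0$ ($n\times n$), $\alpha_i\ge 0$, $L_i\in\mathbb R^{m\times n}$ ($i\in\mathcal I$), $Q\succ0$ ($n\times n$) and $\Pi=[\pi_{i,j}]\in\mathcal M_+$ satisfy, for all $i\in\mathcal I$, $$\begin{bmatrix} Q^{-1} & 0 & P_i^{-1} & 0 & 0 \\ 0 & \boldsymbol\pi_{-i}^{-1}\boldsymbol P_{-i}^{-1} & (\mathbf 1_{N-1}\otimes I_n)P_i^{-1} & 0 & 0 \\ P_i^{-1} & P_i^{-1}(\mathbf 1_{N-1}\otimes I_n)^\top & -\pi_{i,i}P_i^{-1} & -P_i^{-1} & -L_i^\top \\ 0&0&-P_i^{-1}&0&0 \\ 0&0&-L_i&0&0\end{bmatrix}-\alpha_i\,\Gamma_i\,\Phi^i\,\Gamma_i^\top\succcurlyeq 0,\qquad \Gamma_i:=\begin{bmatrix} 0&0 \\ 0&0 \\ I&\dot X_i \\ 0&-X_i \\ 0&-U_i\end{bmatrix}.$$ Then the controller $$\sigma(x)=\min\{\operatorname{argmin}_{i\in\mathcal I}x^\top P_ix\},\qquad u(x)=K_{\sigma(x)}x,\qquad K_i:=L_iP_i,$$ globally asymptotically stabilizes (at the origin) the switched system $\dot x=\bar A_\sigma x+\bar B_\sigma u$. Furthermore, every closed-loop solution satisfies $$\int_0^\infty x(t)^\top Qx(t)\,dt\le\min_{i\in\mathcal I}x(0)^\top P_ix(0).$$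
   Context: Let $\mathcal I=\{1,\dots,N\}$. For each $i\in\mathcal I$, true (unknown) matrices $\bar A_i\in\mathbb R^{n\times n}$, $\bar B_i\in\mathbb R^{n\times m}$ are given, together with data matrices $X_i,\dot X_i\in\mathbb R^{n\times T_i}$, $U_i\in\mathbb R^{m\times T_i}$ (here $\dot X_i$ is just a name) satisfying $\dot X_i=\bar A_iX_i+\bar B_iU_i+\bar W_i$ for an unknown $\bar W_i\in\mathcal W_i$, where $$\mathcal W_i:=\Big\{W\in\mathbb R^{n\times T_i}\ \Big|\ \begin{bmatrix} I \\ W^\top\end{bmatrix}^\top\Phi^i\begin{bmatrix} I \\ W^\top\end{bmatrix}\succcurlyeq 0\Big\},\qquad \Phi^i=\begin{bmatrix}\Phi^i_{1,1}&\Phi^i_{1,2} \\ {\Phi^i_{1,2}}^\top&\Phi^i_{2,2}\end{bmatrix}$$ with known symmetric $\Phi^i$ and $\Phi^i_{2,2}\prec0$ ($\Phi^i_{1,1}$ is $n\times n$, $\Phi^i_{2,2}$ is $T_i\times T_i$). $\mathcal M_+:=\{\Pi\in\mathbb R^{N\times N}\mid \pi_{i,j}>0\ \forall i\ne j,\ \sum_{i=1}^N\pi_{i,j}=0\ \forall j\}$. $\boldsymbol P_{-i}:=\mathrm{diag}((P_j)_{j\in\mathcal I\setminus\{i\}})$, $\boldsymbol\pi_{-i}:=\mathrm{diag}((\pi_{j,i}I_n)_{j\in\mathcal I\setminus\{i\}})$ (block diagonal, same ordering); $\mathbf 1_{N-1}$ is the all-ones vector. The row blocks of $\Gamma_i$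 have heights $n,(N-1)n,n,n,m$ and its column blocks have widths $n,T_i$. Solution concept. Put $\xi_i(x):=(\bar A_i+\bar B_iK_i)x$, $\mathcal X_i:=\{x\in\mathbb R^n\mid\sigma(x)=i\}$, $\mathrm I(x):=\{i\in\mathcal I\mid$ every neighborhood of $x$ meets $\mathcal X_i\}$, and $\dot v_i(x,\xi):=x^\top P_i\xi+\xi^\top P_ix$. A solution of the closed-loop system is an absolutely continuous $x:\mathbb R_{\ge0}\to\mathbb R^n$ such that for almost all $t$ there are weights $\alpha_i\ge0$ ($i\in\mathrm I(x(t))$) with $\sum_{i\in\mathrm I(x(t))}\alpha_i=1$ (unrelated to the scalars $\alpha_i$ in the matrix inequality), for which, with $x=x(t)$, $$\dot x(t)=\sum_{i\in\mathrm I(x)}\alpha_i\xi_i(x)\quad\text{and}\quad \dot v_{\sigma(x)}\Big(x,\sum_{i\in\mathrm I(x)}\alpha_i\xi_i(x)\Big)\le\sum_{i\in\mathrm I(x)}\dot v_i(x,\alpha_i\xi_i(x)).$$ Existence of solutions in this sense is assumed wherever needed. Global asymptotic stability of the origin means that the origin is Lyapunov stable with respect to all such solutions and every such solution converges to $0$ as $t\to\infty$. *)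

theory Defs
  imports "HOL-Analysis.Analysis" "Jordan_Normal_Form.Gauss_Jordan_Elimination"
begin

hide_const (open) Finite_Cartesian_Product.vec Finite_Cartesian_Product.mat
hide_type (open) Finite_Cartesian_Product.vec
unbundle no vec_syntax
unbundle no inner_syntax

text \<open>
  The sample lengths T i depend on the mode and the block structure depends on N, so vectors
  and matrices are of the kind with explicit dimensions.  That vector type carries
  no topology: the Euclidean norm is introduced here, and derivatives are taken
  componentwise.  Modes are the numbers in \<open>{1..N}\<close>.
\<close>

definition norm_vec :: "real vec \<Rightarrow> real" where
  "norm_vec v = sqrt (v \<bullet> v)"

definition quad_form :: "real mat \<Rightarrow> real vec \<Rightarrow> real" where
  "quad_form A x = x \<bullet> (A *\<^sub>v x)"

definition pos_def_mat :: "nat \<Rightarrow> real mat \<Rightarrow> bool" where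
  "pos_def_mat n A \<longleftrightarrow> A \<in> carrier_mat n n \<and> A\<^sup>T = A \<and>
     (\<forall>x \<in> carrier_vec n. x \<noteq> 0\<^sub>v n \<longrightarrow> quad_form A x > 0)"

definition pos_semidef_mat :: "nat \<Rightarrow> real mat \<Rightarrow> bool" where
  "pos_semidef_mat n A \<longleftrightarrow> A \<in> carrier_mat n n \<and> A\<^sup>T = A \<and>
     (\<forall>x \<in> carrier_vec n. quad_form A x \<ge> 0)"

definition neg_def_mat :: "nat \<Rightarrow> real mat \<Rightarrow> bool" where
  "neg_def_mat n A \<longleftrightarrow> pos_def_mat n (- A)"

text \<open>Only applied to invertible matrices.\<close>

definition minv :: "real mat \<Rightarrow> real mat" where
  "minv A = the (mat_inverse A)"

definition kron :: "real mat \<Rightarrow> real mat \<Rightarrow> real mat" where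
  "kron A B = mat (dim_row A * dim_row B) (dim_col A * dim_col B)
     (\<lambda>(r, c). A $$ (r div dim_row B, c div dim_col B) * B $$ (r mod dim_row B, c mod dim_col B))"

fun hcat :: "real mat list \<Rightarrow> real mat" where
  "hcat [] = 0\<^sub>m 0 0"
| "hcat [A] = A"
| "hcat (A # B # Bs) = (let C = hcat (B # Bs)
     in four_block_mat A C (0\<^sub>m 0 (dim_col A)) (0\<^sub>m 0 (dim_col C)))"

fun vcat :: "real mat list \<Rightarrow> real mat" where
  "vcat [] = 0\<^sub>m 0 0"
| "vcat [A] = A"
| "vcat (A # B # Bs) = A @\<^sub>r vcat (B # Bs)"

definition block_mat :: "real mat list list \<Rightarrow> real mat" where
  "block_mat Bss = vcat (map hcat Bss)"

definition noise_set :: "nat \<Rightarrow> nat \<Rightarrow> real mat \<Rightarrow> real mat set" where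
  "noise_set n T \<Phi> = {W \<in> carrier_mat n T.
     pos_semidef_mat n ((block_mat [[1\<^sub>m n], [W\<^sup>T]])\<^sup>T * \<Phi> * block_mat [[1\<^sub>m n], [W\<^sup>T]])}"

definition M_plus :: "nat \<Rightarrow> (nat \<Rightarrow> nat \<Rightarrow> real) set" where
  "M_plus N = {\<pi>. (\<forall>i\<in>{1..N}. \<forall>j\<in>{1..N}. i \<noteq> j \<longrightarrow> \<pi> i j > 0) \<and>
                  (\<forall>j\<in>{1..N}. (\<Sum>i\<in>{1..N}. \<pi> i j) = 0)}"

definition others :: "nat \<Rightarrow> nat \<Rightarrow> nat list" where
  "others N i = filter (\<lambda>j. j \<noteq> i) [1..<Suc N]"

definition P_minus :: "nat \<Rightarrow> (nat \<Rightarrow> real mat) \<Rightarrow> nat \<Rightarrow> real mat" where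
  "P_minus N P i = diag_block_mat (map P (others N i))"

definition pi_minus :: "nat \<Rightarrow> nat \<Rightarrow> (nat \<Rightarrow> nat \<Rightarrow> real) \<Rightarrow> nat \<Rightarrow> real mat" where
  "pi_minus n N \<pi> i = diag_block_mat (map (\<lambda>j. \<pi> j i \<cdot>\<^sub>m 1\<^sub>m n) (others N i))"

definition ones_col :: "nat \<Rightarrow> real mat" where
  "ones_col k = mat k 1 (\<lambda>_. 1)"

definition Gamma_mat ::
  "nat \<Rightarrow> nat \<Rightarrow> nat \<Rightarrow> nat \<Rightarrow> real mat \<Rightarrow> real mat \<Rightarrow> real mat \<Rightarrow> real mat" where
  "Gamma_mat n m N T X Xdot U = block_mat
     [[0\<^sub>m n n,             0\<^sub>m n T],
      [0\<^sub>m ((N - 1) * n) n, 0\<^sub>m ((N - 1) * n) T],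
      [1\<^sub>m n,               Xdot],
      [0\<^sub>m n n,             - X],
      [0\<^sub>m m n,             - U]]"

definition design_mat ::
  "nat \<Rightarrow> nat \<Rightarrow> nat \<Rightarrow> (nat \<Rightarrow> real mat) \<Rightarrow> (nat \<Rightarrow> nat \<Rightarrow> real) \<Rightarrow> real mat \<Rightarrow> real mat
     \<Rightarrow> nat \<Rightarrow> real mat" where
  "design_mat n m N P \<pi> Q L i =
     (let R = minv (P i); E = kron (ones_col (N - 1)) (1\<^sub>m n); k = (N - 1) * n in
      block_mat
      [[minv Q,   0\<^sub>m n k,                                     R,            0\<^sub>m n n, 0\<^sub>m n m],
       [0\<^sub>m k n,  minv (pi_minus n N \<pi> i) * minv (P_minus N P i), E * R,        0\<^sub>m k n, 0\<^sub>m k m],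
       [R,        R * E\<^sup>T,                                     - \<pi> i i \<cdot>\<^sub>m R, - R,     - L\<^sup>T],
       [0\<^sub>m n n,  0\<^sub>m n k,                                     - R,          0\<^sub>m n n, 0\<^sub>m n m],
       [0\<^sub>m m n,  0\<^sub>m m k,                                     - L,          0\<^sub>m m n, 0\<^sub>m m m]])"

definition switching_law :: "nat \<Rightarrow> (nat \<Rightarrow> real mat) \<Rightarrow> real vec \<Rightarrow> nat" where
  "switching_law N P x = Min {i. is_arg_min (\<lambda>i. quad_form (P i) x) (\<lambda>i. i \<in> {1..N}) i}"

definition mode_field ::
  "(nat \<Rightarrow> real mat) \<Rightarrow> (nat \<Rightarrow> real mat) \<Rightarrow> (nat \<Rightarrow> real mat) \<Rightarrow> nat \<Rightarrow> real vec \<Rightarrow> real vec" where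
  "mode_field A B K i x = (A i + B i * K i) *\<^sub>v x"

definition mode_region :: "nat \<Rightarrow> (real vec \<Rightarrow> nat) \<Rightarrow> nat \<Rightarrow> real vec set" where
  "mode_region n \<sigma> i = {x \<in> carrier_vec n. \<sigma> x = i}"

definition active_modes :: "nat \<Rightarrow> nat \<Rightarrow> (real vec \<Rightarrow> nat) \<Rightarrow> real vec \<Rightarrow> nat set" where
  "active_modes n N \<sigma> x =
     {i \<in> {1..N}. \<forall>\<epsilon>>0. \<exists>y \<in> mode_region n \<sigma> i. norm_vec (y - x) < \<epsilon>}"

definition v_dot :: "(nat \<Rightarrow> real mat) \<Rightarrow> nat \<Rightarrow> real vec \<Rightarrow> real vec \<Rightarrow> real" where
  "v_dot P i x \<xi> = x \<bullet> (P i *\<^sub>v \<xi>) + \<xi> \<bullet> (P i *\<^sub>v x)"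

text \<open>
  Absolute continuity on a half-line is understood, as usual for Caratheodory solutions, on
  every compact subinterval.  The members of a division are the nonoverlapping intervals
  \<open>k = {Inf k..Sup k}\<close>.
\<close>

definition abs_continuous_on_interval :: "real \<Rightarrow> real \<Rightarrow> (real \<Rightarrow> real vec) \<Rightarrow> bool" where
  "abs_continuous_on_interval a b x \<longleftrightarrow>
     (\<forall>\<epsilon>>0. \<exists>\<delta>>0. \<forall>d S. d division_of S \<and> S \<subseteq> {a..b} \<and> (\<Sum>k\<in>d. Sup k - Inf k) < \<delta> \<longrightarrow>
        (\<Sum>k\<in>d. norm_vec (x (Sup k) - x (Inf k))) < \<epsilon>)"

definition has_vec_derivative_within ::
  "nat \<Rightarrow> (real \<Rightarrow> real vec) \<Rightarrow> real vec \<Rightarrow> real \<Rightarrow> real set \<Rightarrow> bool" where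
  "has_vec_derivative_within n x x' t S \<longleftrightarrow>
     (\<forall>k<n. ((\<lambda>s. x s $ k) has_real_derivative x' $ k) (at t within S))"

text \<open>Only the values of a trajectory at nonnegative times are constrained.\<close>

definition closed_loop_solutions ::
  "nat \<Rightarrow> nat \<Rightarrow> (nat \<Rightarrow> real mat) \<Rightarrow> (nat \<Rightarrow> real mat) \<Rightarrow> (nat \<Rightarrow> real mat) \<Rightarrow> (nat \<Rightarrow> real mat)
     \<Rightarrow> (real vec \<Rightarrow> nat) \<Rightarrow> (real \<Rightarrow> real vec) set" where
  "closed_loop_solutions n N A B P K \<sigma> = {x.
     (\<forall>t\<ge>0. x t \<in> carrier_vec n) \<and>
     (\<forall>b\<ge>0. abs_continuous_on_interval 0 b x) \<and>
     (AE t in lebesgue. t \<ge> 0 \<longrightarrow>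
       (\<exists>w :: nat \<Rightarrow> real.
          let M = active_modes n N \<sigma> (x t);
              \<xi> = (\<lambda>i. w i \<cdot>\<^sub>v mode_field A B K i (x t));
              F = finsum_vec TYPE(real) n \<xi> M
          in (\<forall>i\<in>M. w i \<ge> 0) \<and> (\<Sum>i\<in>M. w i) = 1 \<and>
             has_vec_derivative_within n x F t {0..} \<and>
             v_dot P (\<sigma> (x t)) (x t) F \<le> (\<Sum>i\<in>M. v_dot P i (x t) (\<xi> i))))}"

definition globally_asymptotically_stable :: "(real \<Rightarrow> real vec) set \<Rightarrow> bool" where
  "globally_asymptotically_stable S \<longleftrightarrow>
     (\<forall>\<epsilon>>0. \<exists>\<delta>>0. \<forall>x\<in>S. norm_vec (x 0) < \<delta> \<longrightarrow> (\<forall>t\<ge>0. norm_vec (x t) < \<epsilon>)) \<and>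
     (\<forall>x\<in>S. ((\<lambda>t. norm_vec (x t)) \<longlongrightarrow> 0) at_top)"

end

theory Submission
  imports Defs "Jordan_Normal_Form.Determinant"
begin

text \<open>
  Evaluating the design inequality at a vector that cancels the data matrices and completes the squares gives the
  Lyapunov-Metzler inequality for the true closed loop of every mode.  Along a solution, the continuous function
  \<open>V x = min\<^sub>i x\<^sup>T P\<^sub>i x\<close> therefore has upper right Dini derivative at most \<open>- x\<^sup>T Q x\<close> almost everywhere: at each
  time \<open>V\<close> lies below the smooth form of the selected mode and touches it, and every active mode is a minimizer.
  As \<open>V\<close> is absolutely continuous along solutions, this integrates to the dissipation inequality
  \<open>V (x b) + \<integral>\<^sub>a\<^sup>b x\<^sup>T Q x \<le> V (x a)\<close>, from which stability, convergence and the cost bound follow.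
\<close>

text \<open>The obstacle is sliding motion on a switching surface. There the velocity is a convex
  combination of the active fields, while the design inequality only says that field i decreases its
  own form; nothing is known about field j acting on form i. The inequality built into the solution
  concept closes exactly this gap: it bounds the derivative of the selected form along the combined
  velocity by the sum of the derivatives of each form along its own share of the velocity. As a
  minimum of smooth functions, V need not be differentiable along a solution even at times when the
  solution is. A minimum lies below each of its members, so its forward increments are bounded by
  those of the selected form, and a one-sided estimate is all that can be expected. Off a null set
  such an estimate does not make a continuous function nonincreasing, as the Cantor function shows;
  hence the monotonicity criterion must use absolute continuity to control g near that set.\<close>

lemma norm_vec_eq_L2_set: "norm_vec v = L2_set (($) v) {..<dim_vec v}"
  by (simp add: norm_vec_def L2_set_def scalar_prod_def power2_eq_square lessThan_atLeast0)

lemma norm_vec_nonneg [simp]: "norm_vec v \<ge> 0"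
  by (simp add: norm_vec_eq_L2_set L2_set_nonneg)

lemma norm_vec_power2: "(norm_vec v)\<^sup>2 = v \<bullet> v"
  by (simp add: norm_vec_def scalar_prod_def sum_nonneg)

lemma abs_index_le_norm_vec:
  assumes "v \<in> carrier_vec n" "k < n"
  shows "\<bar>v $ k\<bar> \<le> norm_vec v"
proof -
  have "\<bar>v $ k\<bar> = sqrt ((v $ k)\<^sup>2)" by simp
  also have "\<dots> \<le> norm_vec v"
    unfolding norm_vec_eq_L2_set L2_set_def using assms
    by (intro real_sqrt_le_mono member_le_sum) auto
  finally show ?thesis .
qed

lemma norm_vec_le_add_norm_diff:
  assumes "x \<in> carrier_vec n" "y \<in> carrier_vec n"
  shows "norm_vec y \<le> norm_vec x + norm_vec (y - x)"
proof -
  have "norm_vec y = L2_set (\<lambda>k. x $ k + (y - x) $ k) {..<n}"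
    using assms by (auto simp: norm_vec_eq_L2_set intro!: L2_set_cong)
  also have "\<dots> \<le> L2_set (($) x) {..<n} + L2_set (($) (y - x)) {..<n}"
    by (rule L2_set_triangle_ineq)
  finally show ?thesis using assms by (simp add: norm_vec_eq_L2_set)
qed

section \<open>Positive definite matrices: inverses, block diagonals and estimates of forms\<close>

lemma pos_def_mat_inverse:
  assumes "pos_def_mat n A"
  shows "minv A \<in> carrier_mat n n" "A * minv A = 1\<^sub>m n" "minv A * A = 1\<^sub>m n"
proof -
  have A: "A \<in> carrier_mat n n" using assms by (simp add: pos_def_mat_def)
  have "Determinant.det A \<noteq> 0"
  proof
    assume "Determinant.det A = 0"
    then obtain v where v: "v \<in> carrier_vec n" "v \<noteq> 0\<^sub>v n" "A *\<^sub>v v = 0\<^sub>v n"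
      using det_0_iff_vec_prod_zero_field[OF A] by blast
    then have "quad_form A v = 0" by (simp add: quad_form_def)
    then show False using assms v unfolding pos_def_mat_def by force
  qed
  \<comment> \<open>\<open>minv\<close> takes \<open>the\<close> of an option, so it says nothing
    until an inverse is known to exist.\<close>
  then have "mat_inverse A \<noteq> None"
    using mat_inverse(1)[OF A, where b = "()"] det_non_zero_imp_unit[OF A, where b = "()"] by blast
  then show "minv A \<in> carrier_mat n n" "A * minv A = 1\<^sub>m n" "minv A * A = 1\<^sub>m n"
    using mat_inverse(2)[OF A] unfolding minv_def by auto
qed

lemma quad_form_diag_block:
  assumes "A \<in> carrier_mat n n" "B \<in> carrier_mat k k" "a \<in> carrier_vec n" "b \<in> carrier_vec k"
  shows "quad_form (four_block_mat A (0\<^sub>m n k) (0\<^sub>m k n) B) (a @\<^sub>v b) = quad_form A a + quad_form B b"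
  using assms mult_mat_vec_split[of A n B k a b]
  by (simp add: quad_form_def scalar_prod_append)

lemma pos_def_mat_diag_block:
  assumes "\<And>A. A \<in> set As \<Longrightarrow> pos_def_mat n A"
  shows "pos_def_mat (length As * n) (diag_block_mat As)"
  using assms
proof (induction As)
  \<comment> \<open>The empty list arises for N = 1. A 0 x 0 matrix is positive definite because
    \<open>carrier_vec 0\<close> contains only the zero vector.\<close>
  case Nil
  have "x = 0\<^sub>v 0" if "x \<in> carrier_vec 0" for x :: "real vec" using that by (intro eq_vecI) auto
  moreover have "(0\<^sub>m 0 0 :: real mat)\<^sup>T = 0\<^sub>m 0 0" by (rule eq_matI) auto
  ultimately show ?case unfolding pos_def_mat_def by simp
next
  case (Cons A As)
  let ?D = "diag_block_mat As" and ?k = "length As * n"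
  have A: "pos_def_mat n A" and D: "pos_def_mat ?k ?D" using Cons by auto
  have cA: "A \<in> carrier_mat n n" and tA: "A\<^sup>T = A" and cD: "?D \<in> carrier_mat ?k ?k" and tD: "?D\<^sup>T = ?D"
    using A D by (auto simp: pos_def_mat_def)
  have eq: "diag_block_mat (A # As) = four_block_mat A (0\<^sub>m n ?k) (0\<^sub>m ?k n) ?D"
    using cA cD by (simp add: Let_def)
  have "quad_form (four_block_mat A (0\<^sub>m n ?k) (0\<^sub>m ?k n) ?D) x > 0"
    if x: "x \<in> carrier_vec (n + ?k)" "x \<noteq> 0\<^sub>v (n + ?k)" for x
  proof -
    define a b where "a = vec_first x n" and "b = vec_last x ?k"
    have ab: "a \<in> carrier_vec n" "b \<in> carrier_vec ?k" by (auto simp: a_def b_def)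
    have xab: "x = a @\<^sub>v b" using vec_first_last_append[OF x(1)] by (simp add: a_def b_def)
    have "a \<noteq> 0\<^sub>v n \<or> b \<noteq> 0\<^sub>v ?k" using x(2) xab by (auto simp: append_vec_def)
    moreover have "a = 0\<^sub>v n \<Longrightarrow> quad_form A a = 0" "b = 0\<^sub>v ?k \<Longrightarrow> quad_form ?D b = 0"
      using cA cD by (auto simp: quad_form_def)
    ultimately have "quad_form A a + quad_form ?D b > 0"
      using A D ab unfolding pos_def_mat_def
      by (cases "a = 0\<^sub>v n"; cases "b = 0\<^sub>v ?k") (auto intro: add_pos_pos)
    then show ?thesis using quad_form_diag_block[OF cA cD ab] xab by simp
  qed
  then show ?case
    unfolding pos_def_mat_def eq using cA cD tA tD
    by (auto simp: transpose_four_block_mat[OF cA zero_carrier_mat zero_carrier_mat cD])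
qed

lemma bilinear_form_bound:
  fixes A :: "real mat"
  assumes A: "A \<in> carrier_mat n n"
  obtains C where "C > 0"
    "\<And>x y. x \<in> carrier_vec n \<Longrightarrow> y \<in> carrier_vec n \<Longrightarrow> \<bar>x \<bullet> (A *\<^sub>v y)\<bar> \<le> C * norm_vec x * norm_vec y"
proof
  \<comment> \<open>The sum of the absolute entries is already a bound; the added 1 keeps the
    constant positive for a zero or empty matrix.\<close>
  let ?S = "\<Sum>i<n. \<Sum>j<n. \<bar>A $$ (i, j)\<bar>"
  show "?S + 1 > 0" by (simp add: add_nonneg_pos sum_nonneg)
  fix x y :: "real vec" assume x: "x \<in> carrier_vec n" and y: "y \<in> carrier_vec n"
  have "x \<bullet> (A *\<^sub>v y) = (\<Sum>i<n. \<Sum>j<n. x $ i * A $$ (i, j) * y $ j)"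
    using A x y by (auto simp: scalar_prod_def sum_distrib_left mult.assoc lessThan_atLeast0 intro!: sum.cong)
  also have "\<bar>\<dots>\<bar> \<le> (\<Sum>i<n. \<Sum>j<n. \<bar>x $ i * A $$ (i, j) * y $ j\<bar>)"
    by (rule order_trans[OF sum_abs sum_mono[OF sum_abs]])
  also have "\<dots> \<le> (\<Sum>i<n. \<Sum>j<n. norm_vec x * \<bar>A $$ (i, j)\<bar> * norm_vec y)"
    using abs_index_le_norm_vec[OF x] abs_index_le_norm_vec[OF y]
    by (intro sum_mono) (auto simp: abs_mult intro!: mult_mono)
  also have "\<dots> = ?S * norm_vec x * norm_vec y"
    by (simp add: sum_distrib_left sum_distrib_right mult_ac)
  also have "\<dots> \<le> (?S + 1) * norm_vec x * norm_vec y"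
    by (auto simp: algebra_simps)
  finally show "\<bar>x \<bullet> (A *\<^sub>v y)\<bar> \<le> (?S + 1) * norm_vec x * norm_vec y" .
qed

text \<open>On bounded sets this is a Lipschitz estimate. It serves twice: for limits at switching
  surfaces and for the absolute continuity of V along solutions.\<close>

lemma quad_form_diff_bound:
  fixes A :: "real mat"
  assumes A: "A \<in> carrier_mat n n"
  obtains C where "C > 0"
    "\<And>x y. x \<in> carrier_vec n \<Longrightarrow> y \<in> carrier_vec n \<Longrightarrow>
       \<bar>quad_form A y - quad_form A x\<bar> \<le> C * norm_vec (y - x) * (norm_vec x + norm_vec y)"
proof -
  obtain C where C: "C > 0"
    "\<And>x y. x \<in> carrier_vec n \<Longrightarrow> y \<in> carrier_vec n \<Longrightarrow> \<bar>x \<bullet> (A *\<^sub>v y)\<bar> \<le> C * norm_vec x * norm_vec y"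
    using bilinear_form_bound[OF A] by blast
  have "\<bar>quad_form A y - quad_form A x\<bar> \<le> C * norm_vec (y - x) * (norm_vec x + norm_vec y)"
    if x: "x \<in> carrier_vec n" and y: "y \<in> carrier_vec n" for x y
  proof -
    have "quad_form A y - quad_form A x = (y - x) \<bullet> (A *\<^sub>v y) + x \<bullet> (A *\<^sub>v (y - x))"
      using A x y
      by (simp add: quad_form_def minus_scalar_prod_distrib[of _ n] mult_minus_distrib_mat_vec
          scalar_prod_minus_distrib[of _ n])
    then show ?thesis
      using C(2)[of "y - x" y] C(2)[of x "y - x"] x y by (simp add: algebra_simps)
  qed
  with C(1) that show ?thesis by blast
qed

text \<open>Expanding the form at \<open>x - s A\<^sup>-\<^sup>1 x\<close> replaces the usual compactness argument.\<close>

lemma pos_def_mat_coercive: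
  assumes pd: "pos_def_mat n A"
  obtains c where "c > 0" "\<And>x. x \<in> carrier_vec n \<Longrightarrow> c * (norm_vec x)\<^sup>2 \<le> quad_form A x"
proof -
  have A: "A \<in> carrier_mat n n" and tA: "A\<^sup>T = A" using pd by (auto simp: pos_def_mat_def)
  note inv = pos_def_mat_inverse[OF pd]
  obtain C where C: "C > 0" "\<And>x y. x \<in> carrier_vec n \<Longrightarrow> y \<in> carrier_vec n \<Longrightarrow>
      \<bar>x \<bullet> (minv A *\<^sub>v y)\<bar> \<le> C * norm_vec x * norm_vec y"
    using bilinear_form_bound[OF inv(1)] by blast
  have "1 / C * (norm_vec x)\<^sup>2 \<le> quad_form A x" if x: "x \<in> carrier_vec n" for x
  proof -
    define y where "y = minv A *\<^sub>v x"
    have y: "y \<in> carrier_vec n" using inv x by (simp add: y_def)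
    have Ay: "A *\<^sub>v y = x" using A inv x by (simp add: y_def flip: assoc_mult_mat_vec)
    \<comment> \<open>Nonnegativity of the expanded form bounds \<open>quad_form A x\<close> below
      by \<open>2 * s - s^2 * C\<close> times the squared norm. This factor is largest at s = 1 / C,
      where it equals s.\<close>
    define s where "s = 1 / C"
    have z: "x - s \<cdot>\<^sub>v y \<in> carrier_vec n" using x y by simp
    have yAx: "y \<bullet> (A *\<^sub>v x) = x \<bullet> x"
      using transpose_vec_mult_scalar[OF A x y] A x y Ay tA
      by (simp add: comm_scalar_prod[of _ n])
    have yx: "y \<bullet> x \<le> C * (norm_vec x)\<^sup>2"
      using C(2)[OF x x] x y by (simp add: y_def power2_eq_square mult.assoc comm_scalar_prod[of _ n])
    have "quad_form A (x - s \<cdot>\<^sub>v y) = quad_form A x - 2 * s * (x \<bullet> x) + s\<^sup>2 * (y \<bullet> x)"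
      using A x y Ay yAx
      by (simp add: quad_form_def minus_scalar_prod_distrib[of _ n] mult_minus_distrib_mat_vec
          scalar_prod_minus_distrib[of _ n] mult_mat_vec power2_eq_square algebra_simps)
    moreover have "quad_form A (x - s \<cdot>\<^sub>v y) \<ge> 0"
    proof (cases "x - s \<cdot>\<^sub>v y = 0\<^sub>v n")
      case True
      then show ?thesis using A by (simp add: quad_form_def)
    next
      case False
      then show ?thesis using pd z unfolding pos_def_mat_def by force
    qed
    moreover have "s\<^sup>2 * (y \<bullet> x) \<le> s * (norm_vec x)\<^sup>2"
      using mult_left_mono[OF yx, of "s\<^sup>2"] C(1) by (simp add: s_def power2_eq_square field_simps)
    ultimately show ?thesis by (simp add: s_def norm_vec_power2)
  qed
  with C(1) that[of "1 / C"] show ?thesis by simp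
qed

section \<open>Block matrices acting on stacked vectors\<close>

lemma hcat_carrier:
  assumes "A \<in> carrier_mat r c" "hcat (B # Bs) \<in> carrier_mat r k"
  shows "hcat (A # B # Bs) \<in> carrier_mat r (c + k)"
  using assms by (auto simp: Let_def)

text \<open>\<open>hcat\<close> is a four-block matrix whose lower blocks have height zero, so the
  block product ends in an empty vector, which is dropped. The tail \<open>B # Bs\<close> is
  nonempty since \<open>hcat []\<close> has no rows.\<close>

lemma hcat_mult_vec:
  assumes A: "A \<in> carrier_mat r c" and C: "hcat (B # Bs) \<in> carrier_mat r k"
    and "a \<in> carrier_vec c" "b \<in> carrier_vec k"
  shows "hcat (A # B # Bs) *\<^sub>v (a @\<^sub>v b) = A *\<^sub>v a + hcat (B # Bs) *\<^sub>v b"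
proof -
  have "hcat (A # B # Bs) = four_block_mat A (hcat (B # Bs)) (0\<^sub>m 0 c) (0\<^sub>m 0 k)"
    using A C by (auto simp: Let_def)
  then have "hcat (A # B # Bs) *\<^sub>v (a @\<^sub>v b) =
      (A *\<^sub>v a + hcat (B # Bs) *\<^sub>v b) @\<^sub>v (0\<^sub>m 0 c *\<^sub>v a + 0\<^sub>m 0 k *\<^sub>v b)"
    using four_block_mat_mult_vec[OF A C zero_carrier_mat zero_carrier_mat assms(3,4)] by simp
  also have "\<dots> = A *\<^sub>v a + hcat (B # Bs) *\<^sub>v b"
    by (intro eq_vecI) auto
  finally show ?thesis .
qed

lemma transpose_hcat_mult_vec:
  assumes A: "A \<in> carrier_mat r c" and C: "hcat (B # Bs) \<in> carrier_mat r k" and v: "v \<in> carrier_vec r"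
  shows "(hcat (A # B # Bs))\<^sup>T *\<^sub>v v = (A\<^sup>T *\<^sub>v v) @\<^sub>v ((hcat (B # Bs))\<^sup>T *\<^sub>v v)"
proof -
  have "hcat (A # B # Bs) = four_block_mat A (hcat (B # Bs)) (0\<^sub>m 0 c) (0\<^sub>m 0 k)"
    using A C by (auto simp: Let_def)
  then have "(hcat (A # B # Bs))\<^sup>T = A\<^sup>T @\<^sub>r (hcat (B # Bs))\<^sup>T"
    using A C by (auto simp: append_rows_def transpose_four_block_mat[OF A C zero_carrier_mat zero_carrier_mat]
        zero_transpose_mat)
  then show ?thesis
    using A C v by (simp only: mat_mult_append[of _ c r _ k] transpose_carrier_mat)
qed

lemma transpose_append_rows_mult_vec:
  assumes A: "(A :: real mat) \<in> carrier_mat r c" and B: "B \<in> carrier_mat k c"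
    and a: "a \<in> carrier_vec r" and b: "b \<in> carrier_vec k"
  shows "(A @\<^sub>r B)\<^sup>T *\<^sub>v (a @\<^sub>v b) = A\<^sup>T *\<^sub>v a + B\<^sup>T *\<^sub>v b"
proof -
  have "(A @\<^sub>r B)\<^sup>T = four_block_mat (A\<^sup>T) (B\<^sup>T) (0\<^sub>m 0 r) (0\<^sub>m 0 k)"
    using A B transpose_four_block_mat[OF A zero_carrier_mat B zero_carrier_mat, of 0]
    by (auto simp: append_rows_def zero_transpose_mat)
  then have "(A @\<^sub>r B)\<^sup>T *\<^sub>v (a @\<^sub>v b) = (A\<^sup>T *\<^sub>v a + B\<^sup>T *\<^sub>v b) @\<^sub>v (0\<^sub>m 0 r *\<^sub>v a + 0\<^sub>m 0 k *\<^sub>v b)"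
    using four_block_mat_mult_vec[of "A\<^sup>T" c r "B\<^sup>T" k "0\<^sub>m 0 r" 0 "0\<^sub>m 0 k" a b] assms by simp
  also have "\<dots> = A\<^sup>T *\<^sub>v a + B\<^sup>T *\<^sub>v b"
    by (intro eq_vecI) auto
  finally show ?thesis .
qed

lemma vcat_carrier:
  assumes "A \<in> carrier_mat r c" "vcat (B # Bs) \<in> carrier_mat k c"
  shows "vcat (A # B # Bs) \<in> carrier_mat (r + k) c"
  using assms by simp

lemma transpose_vcat5_mult_vec:
  assumes B: "B1 \<in> carrier_mat r1 c" "B2 \<in> carrier_mat r2 c" "B3 \<in> carrier_mat r3 c" "B4 \<in> carrier_mat r4 c"
      "B5 \<in> carrier_mat r5 c"
    and z: "z1 \<in> carrier_vec r1" "z2 \<in> carrier_vec r2" "z3 \<in> carrier_vec r3" "z4 \<in> carrier_vec r4" "z5 \<in> carrier_vec r5"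
  shows "(vcat [B1, B2, B3, B4, B5])\<^sup>T *\<^sub>v (z1 @\<^sub>v z2 @\<^sub>v z3 @\<^sub>v z4 @\<^sub>v z5) =
    B1\<^sup>T *\<^sub>v z1 + (B2\<^sup>T *\<^sub>v z2 + (B3\<^sup>T *\<^sub>v z3 + (B4\<^sup>T *\<^sub>v z4 + B5\<^sup>T *\<^sub>v z5)))"
proof -
  note c4 = carrier_append_rows[OF B(4,5)] append_carrier_vec[OF z(4,5)]
  note c3 = carrier_append_rows[OF B(3) c4(1)] append_carrier_vec[OF z(3) c4(2)]
  note c2 = carrier_append_rows[OF B(2) c3(1)] append_carrier_vec[OF z(2) c3(2)]
  show ?thesis
    using transpose_append_rows_mult_vec[OF B(1) c2(1) z(1) c2(2)] transpose_append_rows_mult_vec[OF B(2) c3(1) z(2) c3(2)]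
      transpose_append_rows_mult_vec[OF B(3) c4(1) z(3) c4(2)] transpose_append_rows_mult_vec[OF B(4,5) z(4,5)]
    by simp
qed

lemma scalar_prod_append5:
  fixes z1 z2 z3 z4 z5 y1 y2 y3 y4 y5 :: "real vec"
  assumes z: "z1 \<in> carrier_vec r1" "z2 \<in> carrier_vec r2" "z3 \<in> carrier_vec r3" "z4 \<in> carrier_vec r4" "z5 \<in> carrier_vec r5"
    and y: "y1 \<in> carrier_vec r1" "y2 \<in> carrier_vec r2" "y3 \<in> carrier_vec r3" "y4 \<in> carrier_vec r4" "y5 \<in> carrier_vec r5"
  shows "(z1 @\<^sub>v z2 @\<^sub>v z3 @\<^sub>v z4 @\<^sub>v z5) \<bullet> (y1 @\<^sub>v y2 @\<^sub>v y3 @\<^sub>v y4 @\<^sub>v y5) =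
    z1 \<bullet> y1 + (z2 \<bullet> y2 + (z3 \<bullet> y3 + (z4 \<bullet> y4 + z5 \<bullet> y5)))"
proof -
  note c4 = append_carrier_vec[OF z(4,5)] append_carrier_vec[OF y(4,5)]
  note c3 = append_carrier_vec[OF z(3) c4(1)] append_carrier_vec[OF y(3) c4(2)]
  note c2 = append_carrier_vec[OF z(2) c3(1)] append_carrier_vec[OF y(2) c3(2)]
  show ?thesis
    using scalar_prod_append[OF z(1) c2(1) y(1) c2(2)] scalar_prod_append[OF z(2) c3(1) y(2) c3(2)]
      scalar_prod_append[OF z(3) c4(1) y(3) c4(2)] scalar_prod_append[OF z(4,5) y(4,5)]
    by simp
qed

lemma zero_mult_mat_vec: "v \<in> carrier_vec c \<Longrightarrow> 0\<^sub>m r c *\<^sub>v v = (0\<^sub>v r :: real vec)"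
  by (intro eq_vecI) auto

lemma Gamma_mat_carrier:
  assumes "X \<in> carrier_mat n T" "Xdot \<in> carrier_mat n T" "U \<in> carrier_mat m T"
  shows "Gamma_mat n m N T X Xdot U \<in> carrier_mat (n + ((N - 1) * n + (n + (n + m)))) (n + T)"
  unfolding Gamma_mat_def block_mat_def list.map using assms
  by (intro vcat_carrier) (auto simp del: hcat.simps(3) intro!: hcat_carrier)

text \<open>Only the third block row has an entry in the first column, hence z3 is copied unchanged;
  z1 and z2 meet zero rows and remain free for completing squares.\<close>

lemma transpose_Gamma_mat_mult_vec:
  assumes X: "X \<in> carrier_mat n T" and Xdot: "Xdot \<in> carrier_mat n T" and U: "U \<in> carrier_mat m T"
    and z: "z1 \<in> carrier_vec n" "z2 \<in> carrier_vec ((N - 1) * n)" "z3 \<in> carrier_vec n"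
      "z4 \<in> carrier_vec n" "z5 \<in> carrier_vec m"
  shows "(Gamma_mat n m N T X Xdot U)\<^sup>T *\<^sub>v (z1 @\<^sub>v z2 @\<^sub>v z3 @\<^sub>v z4 @\<^sub>v z5) =
    z3 @\<^sub>v (Xdot\<^sup>T *\<^sub>v z3 - (X\<^sup>T *\<^sub>v z4 + U\<^sup>T *\<^sub>v z5))"
proof -
  let ?k = "(N - 1) * n"
  have rows: "(hcat [F, G])\<^sup>T *\<^sub>v v = (F\<^sup>T *\<^sub>v v) @\<^sub>v (G\<^sup>T *\<^sub>v v)" "hcat [F, G] \<in> carrier_mat r (n + T)"
    if "F \<in> carrier_mat r n" "G \<in> carrier_mat r T" "v \<in> carrier_vec r" for F G r v
    using transpose_hcat_mult_vec[of F r n G "[]" T v] hcat_carrier[of F r n G "[]" T] that by auto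
  have c: "hcat [0\<^sub>m n n, 0\<^sub>m n T] \<in> carrier_mat n (n + T)" 
    "hcat [0\<^sub>m ?k n, 0\<^sub>m ?k T] \<in> carrier_mat ?k (n + T)" 
    "hcat [1\<^sub>m n, Xdot] \<in> carrier_mat n (n + T)" 
    "hcat [0\<^sub>m n n, - X] \<in> carrier_mat n (n + T)" 
    "hcat [0\<^sub>m m n, - U] \<in> carrier_mat m (n + T)" 
    using rows(2) assms by auto
  have add: "(a @\<^sub>v b) + (c @\<^sub>v d) = (a + c) @\<^sub>v (b + d)"
    if "a \<in> carrier_vec n" "c \<in> carrier_vec n" "b \<in> carrier_vec T" "d \<in> carrier_vec T" for a b c d :: "real vec"
    using append_vec_add[OF that] by simp
  have tneg: "(- M)\<^sup>T *\<^sub>v v = - (M\<^sup>T *\<^sub>v v)" if "M \<in> carrier_mat r c" "v \<in> carrier_vec r" for M :: "real mat" and r c v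
    using that by (intro eq_vecI) (auto simp: scalar_prod_def sum_negf)
  have r0: "(hcat [0\<^sub>m r n, 0\<^sub>m r T])\<^sup>T *\<^sub>v v = 0\<^sub>v n @\<^sub>v 0\<^sub>v T" if "v \<in> carrier_vec r" for r v
    using rows(1)[OF zero_carrier_mat zero_carrier_mat that] that by (simp add: zero_transpose_mat zero_mult_mat_vec)
  have r3: "(hcat [1\<^sub>m n, Xdot])\<^sup>T *\<^sub>v z3 = z3 @\<^sub>v (Xdot\<^sup>T *\<^sub>v z3)"
    using rows(1)[OF one_carrier_mat Xdot z(3)] z(3) by simp
  have rn: "(hcat [0\<^sub>m r n, - M])\<^sup>T *\<^sub>v v = 0\<^sub>v n @\<^sub>v - (M\<^sup>T *\<^sub>v v)"
    if "M \<in> carrier_mat r T" "v \<in> carrier_vec r" for M r v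
    using rows(1)[OF zero_carrier_mat _ that(2), of "- M"] that
    by (simp add: zero_transpose_mat zero_mult_mat_vec tneg)
  note r = r0[OF z(1)] r0[OF z(2)] r3 rn[OF X z(4)] rn[OF U z(5)]
  have "(Gamma_mat n m N T X Xdot U)\<^sup>T *\<^sub>v (z1 @\<^sub>v z2 @\<^sub>v z3 @\<^sub>v z4 @\<^sub>v z5) =
      (hcat [0\<^sub>m n n, 0\<^sub>m n T])\<^sup>T *\<^sub>v z1 + ((hcat [0\<^sub>m ?k n, 0\<^sub>m ?k T])\<^sup>T *\<^sub>v z2 + ((hcat [1\<^sub>m n, Xdot])\<^sup>T *\<^sub>v z3
       + ((hcat [0\<^sub>m n n, - X])\<^sup>T *\<^sub>v z4 + (hcat [0\<^sub>m m n, - U])\<^sup>T *\<^sub>v z5)))"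
    unfolding Gamma_mat_def block_mat_def list.map by (rule transpose_vcat5_mult_vec[OF c z])
  also have "\<dots> = z3 @\<^sub>v (Xdot\<^sup>T *\<^sub>v z3 + (- (X\<^sup>T *\<^sub>v z4) + - (U\<^sup>T *\<^sub>v z5)))"
    unfolding r using assms by (simp add: add)
  also have "\<dots> = z3 @\<^sub>v (Xdot\<^sup>T *\<^sub>v z3 - (X\<^sup>T *\<^sub>v z4 + U\<^sup>T *\<^sub>v z5))"
    using assms by (intro arg_cong[of _ _ "\<lambda>v. z3 @\<^sub>v v"] eq_vecI) auto
  finally show ?thesis .
qed

text \<open>With the blocks left abstract, the eleven nonzero ones give eleven terms before any
  inverse or Kronecker product is substituted.\<close>

lemma quad_form_block_mat5:
  assumes S: "S1 \<in> carrier_mat n n" "S2 \<in> carrier_mat k k"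
    and M: "R \<in> carrier_mat n n" "F \<in> carrier_mat k n" "G \<in> carrier_mat n k" "H \<in> carrier_mat n n" "L \<in> carrier_mat m n"
    and z: "z1 \<in> carrier_vec n" "z2 \<in> carrier_vec k" "z3 \<in> carrier_vec n"
      "z4 \<in> carrier_vec n" "z5 \<in> carrier_vec m"
  defines "D \<equiv> block_mat
      [[S1,   0\<^sub>m n k,   R,   0\<^sub>m n n, 0\<^sub>m n m],
       [0\<^sub>m k n,  S2, F,        0\<^sub>m k n, 0\<^sub>m k m],
       [R,        G,   H, - R,     - L\<^sup>T],
       [0\<^sub>m n n,  0\<^sub>m n k,   - R,          0\<^sub>m n n, 0\<^sub>m n m],
       [0\<^sub>m m n,  0\<^sub>m m k,   - L,          0\<^sub>m m n, 0\<^sub>m m m]]"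
  shows "D \<in> carrier_mat (n + (k + (n + (n + m)))) (n + (k + (n + (n + m))))"
    and "quad_form D (z1 @\<^sub>v z2 @\<^sub>v z3 @\<^sub>v z4 @\<^sub>v z5) =
      z1 \<bullet> (S1 *\<^sub>v z1) + z2 \<bullet> (S2 *\<^sub>v z2) + z3 \<bullet> (H *\<^sub>v z3) + z1 \<bullet> (R *\<^sub>v z3) + z3 \<bullet> (R *\<^sub>v z1)
      + z2 \<bullet> (F *\<^sub>v z3) + z3 \<bullet> (G *\<^sub>v z2) - z3 \<bullet> (R *\<^sub>v z4) - z4 \<bullet> (R *\<^sub>v z3)
      - z3 \<bullet> (L\<^sup>T *\<^sub>v z5) - z5 \<bullet> (L *\<^sub>v z3)"
proof -
  let ?d = "n + (k + (n + (n + m)))" and ?z = "z1 @\<^sub>v z2 @\<^sub>v z3 @\<^sub>v z4 @\<^sub>v z5"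
  have hc: "hcat [A1, A2, A3, A4, A5] \<in> carrier_mat r ?d"
    and hm: "hcat [A1, A2, A3, A4, A5] *\<^sub>v ?z = A1 *\<^sub>v z1 + (A2 *\<^sub>v z2 + (A3 *\<^sub>v z3 + (A4 *\<^sub>v z4 + A5 *\<^sub>v z5)))"
    if A: "A1 \<in> carrier_mat r n" "A2 \<in> carrier_mat r k" "A3 \<in> carrier_mat r n" "A4 \<in> carrier_mat r n" "A5 \<in> carrier_mat r m"
    for A1 A2 A3 A4 A5 r
  proof -
    have c4: "hcat [A4, A5] \<in> carrier_mat r (n + m)" using hcat_carrier[of A4 r n A5 "[]" m] A by simp
    have c3: "hcat [A3, A4, A5] \<in> carrier_mat r (n + (n + m))" using hcat_carrier[OF A(3) c4] .
    have c2: "hcat [A2, A3, A4, A5] \<in> carrier_mat r (k + (n + (n + m)))" using hcat_carrier[OF A(2) c3] .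
    show "hcat [A1, A2, A3, A4, A5] \<in> carrier_mat r ?d" using hcat_carrier[OF A(1) c2] .
    show "hcat [A1, A2, A3, A4, A5] *\<^sub>v ?z = A1 *\<^sub>v z1 + (A2 *\<^sub>v z2 + (A3 *\<^sub>v z3 + (A4 *\<^sub>v z4 + A5 *\<^sub>v z5)))"
      using A z c2 c3 c4 hcat_mult_vec[OF A(1) c2] hcat_mult_vec[OF A(2) c3] hcat_mult_vec[OF A(3) c4]
        hcat_mult_vec[of A4 r n A5 "[]" m]
      by (simp del: hcat.simps(3))
  qed
  have vc: "vcat [B1, B2, B3, B4, B5] \<in> carrier_mat ?d ?d"
    and vm: "vcat [B1, B2, B3, B4, B5] *\<^sub>v ?z = B1 *\<^sub>v ?z @\<^sub>v B2 *\<^sub>v ?z @\<^sub>v B3 *\<^sub>v ?z @\<^sub>v B4 *\<^sub>v ?z @\<^sub>v B5 *\<^sub>v ?z"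
    if B: "B1 \<in> carrier_mat n ?d" "B2 \<in> carrier_mat k ?d" "B3 \<in> carrier_mat n ?d" "B4 \<in> carrier_mat n ?d"
      "B5 \<in> carrier_mat m ?d" for B1 B2 B3 B4 B5
  proof -
    have zc: "?z \<in> carrier_vec ?d" using z by simp
    have c4: "B4 @\<^sub>r B5 \<in> carrier_mat (n + m) ?d" using B by simp
    have c3: "B3 @\<^sub>r B4 @\<^sub>r B5 \<in> carrier_mat (n + (n + m)) ?d" using B c4 by simp
    have c2: "B2 @\<^sub>r B3 @\<^sub>r B4 @\<^sub>r B5 \<in> carrier_mat (k + (n + (n + m))) ?d" using B c3 by simp
    show "vcat [B1, B2, B3, B4, B5] \<in> carrier_mat ?d ?d" using B c2 by simp
    show "vcat [B1, B2, B3, B4, B5] *\<^sub>v ?z = B1 *\<^sub>v ?z @\<^sub>v B2 *\<^sub>v ?z @\<^sub>v B3 *\<^sub>v ?z @\<^sub>v B4 *\<^sub>v ?z @\<^sub>v B5 *\<^sub>v ?z"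
      using mat_mult_append[OF B(1) c2 zc] mat_mult_append[OF B(2) c3 zc] mat_mult_append[OF B(3) c4 zc]
        mat_mult_append[OF B(4,5) zc] by simp
  qed
  have zc: "?z \<in> carrier_vec ?d" using z by simp
  let ?r1 = "hcat [S1, 0\<^sub>m n k, R, 0\<^sub>m n n, 0\<^sub>m n m]" and ?r2 = "hcat [0\<^sub>m k n, S2, F, 0\<^sub>m k n, 0\<^sub>m k m]"
    and ?r3 = "hcat [R, G, H, - R, - L\<^sup>T]" and ?r4 = "hcat [0\<^sub>m n n, 0\<^sub>m n k, - R, 0\<^sub>m n n, 0\<^sub>m n m]"
    and ?r5 = "hcat [0\<^sub>m m n, 0\<^sub>m m k, - L, 0\<^sub>m m n, 0\<^sub>m m m]"
  have D: "D = vcat [?r1, ?r2, ?r3, ?r4, ?r5]" by (simp only: D_def block_mat_def list.map)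
  have rc: "?r1 \<in> carrier_mat n ?d" "?r2 \<in> carrier_mat k ?d" "?r3 \<in> carrier_mat n ?d" "?r4 \<in> carrier_mat n ?d"
    "?r5 \<in> carrier_mat m ?d"
    by (rule hc; use assms in simp)+
  show "D \<in> carrier_mat ?d ?d" unfolding D by (rule vc[OF rc])
  have neg: "(- M) *\<^sub>v v = - (M *\<^sub>v v)" if "M \<in> carrier_mat r c" "v \<in> carrier_vec c" for M :: "real mat" and r c v
    using that by (intro eq_vecI) (auto simp: scalar_prod_def sum_negf)
  have rm: "?r1 *\<^sub>v ?z = S1 *\<^sub>v z1 + R *\<^sub>v z3" "?r2 *\<^sub>v ?z = S2 *\<^sub>v z2 + F *\<^sub>v z3"
    "?r3 *\<^sub>v ?z = R *\<^sub>v z1 + (G *\<^sub>v z2 + (H *\<^sub>v z3 + (- (R *\<^sub>v z4) + - (L\<^sup>T *\<^sub>v z5))))"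
    "?r4 *\<^sub>v ?z = - (R *\<^sub>v z3)" "?r5 *\<^sub>v ?z = - (L *\<^sub>v z3)"
    using assms
    by (simp_all add: hm[of _ n] hm[of _ k] hm[of _ m] zero_mult_mat_vec neg[of R n n] neg[of L m n] neg[of "L\<^sup>T" n m]
        del: hcat.simps(3))
  have "quad_form D ?z = z1 \<bullet> (?r1 *\<^sub>v ?z) + (z2 \<bullet> (?r2 *\<^sub>v ?z) + (z3 \<bullet> (?r3 *\<^sub>v ?z) + (z4 \<bullet> (?r4 *\<^sub>v ?z) + z5 \<bullet> (?r5 *\<^sub>v ?z))))"
    unfolding quad_form_def D vm[OF rc] by (rule scalar_prod_append5[OF z rc[THEN mult_mat_vec_carrier[OF _ zc]]])
  also have "\<dots> = z1 \<bullet> (S1 *\<^sub>v z1) + z2 \<bullet> (S2 *\<^sub>v z2) + z3 \<bullet> (H *\<^sub>v z3) + z1 \<bullet> (R *\<^sub>v z3) + z3 \<bullet> (R *\<^sub>v z1)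
      + z2 \<bullet> (F *\<^sub>v z3) + z3 \<bullet> (G *\<^sub>v z2) - z3 \<bullet> (R *\<^sub>v z4) - z4 \<bullet> (R *\<^sub>v z3)
      - z3 \<bullet> (L\<^sup>T *\<^sub>v z5) - z5 \<bullet> (L *\<^sub>v z3)"
    unfolding rm using S M z by (simp add: scalar_prod_add_distrib[of _ n] scalar_prod_add_distrib[of _ k])
  finally show "quad_form D ?z = \<dots>" .
qed

section \<open>Stacked copies of a vector and block-diagonal weights\<close>

lemma kron_ones_carrier: "kron (ones_col l) (1\<^sub>m n) \<in> carrier_mat (l * n) n"
  by (simp add: kron_def ones_col_def)

lemma kron_ones_mult_vec:
  assumes "x \<in> carrier_vec n"
  shows "kron (ones_col l) (1\<^sub>m n) *\<^sub>v x = vec (l * n) (\<lambda>r. x $ (r mod n))"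
proof (rule eq_vecI)
  fix r assume "r < dim_vec (vec (l * n) (\<lambda>r. x $ (r mod n)))"
  then have r: "r < l * n" by simp
  \<comment> \<open>An index below \<open>l * n\<close> exists only if n is positive, so
    \<open>r mod n\<close> is a valid position.\<close>
  then have n: "n > 0" by (cases n) auto
  have "r div n < l" using r by (simp add: less_mult_imp_div_less)
  then have row: "row (kron (ones_col l) (1\<^sub>m n)) r = unit_vec n (r mod n)"
    using r n by (intro eq_vecI) (auto simp: kron_def ones_col_def)
  have "(kron (ones_col l) (1\<^sub>m n) *\<^sub>v x) $ r = unit_vec n (r mod n) \<bullet> x"
    using r row by (simp add: kron_def ones_col_def)
  also have "\<dots> = x $ (r mod n)" using assms n by simp
  finally show "(kron (ones_col l) (1\<^sub>m n) *\<^sub>v x) $ r = vec (l * n) (\<lambda>r. x $ (r mod n)) $ r"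
    using r by simp
qed (simp add: kron_def ones_col_def)

text \<open>Peels one copy off the stack, matching the recursion of
  \<open>diag_block_mat\<close>.\<close>

lemma kron_ones_mult_vec_Suc:
  assumes "x \<in> carrier_vec n"
  shows "kron (ones_col (Suc l)) (1\<^sub>m n) *\<^sub>v x = x @\<^sub>v (kron (ones_col l) (1\<^sub>m n) *\<^sub>v x)"
  unfolding kron_ones_mult_vec[OF assms] using assms
  by (intro eq_vecI) (auto simp: le_mod_geq)

lemma smult_one_mult_vec: "x \<in> carrier_vec n \<Longrightarrow> (c \<cdot>\<^sub>m 1\<^sub>m n) *\<^sub>v x = (c :: real) \<cdot>\<^sub>v x"
  by (intro eq_vecI) (auto simp: row_smult)

lemma diag_block_mat_carrier:
  assumes "\<And>A. A \<in> set As \<Longrightarrow> A \<in> carrier_mat n n"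
  shows "diag_block_mat As \<in> carrier_mat (length As * n) (length As * n)"
  using assms by (induction As) (auto simp: Let_def)

text \<open>Each step of the induction removes one diagonal block together with one copy of x. The
  result becomes the off-diagonal part of the Metzler sum; the two factors stand in the order in
  which the second diagonal block of the design matrix inverts them.\<close>

lemma diag_block_mat_weighted_sum:
  assumes "\<And>j. j \<in> set js \<Longrightarrow> P j \<in> carrier_mat n n" and x: "x \<in> carrier_vec n"
  defines "e l \<equiv> kron (ones_col l) (1\<^sub>m n) *\<^sub>v x"
  shows "(diag_block_mat (map P js) *\<^sub>v (diag_block_mat (map (\<lambda>j. c j \<cdot>\<^sub>m 1\<^sub>m n) js) *\<^sub>v e (length js))) \<bullet> e (length js)
    = (\<Sum>j\<leftarrow>js. c j * quad_form (P j) x)"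
  using assms(1)
proof (induction js)
  case Nil
  have "dim_vec (e 0) = 0" by (simp add: e_def kron_def ones_col_def)
  then show ?case by (simp add: scalar_prod_def)
next
  case (Cons j js)
  let ?k = "length js * n" and ?P = "diag_block_mat (map P js)" and ?C = "diag_block_mat (map (\<lambda>j. c j \<cdot>\<^sub>m 1\<^sub>m n) js)"
  have Pj: "P j \<in> carrier_mat n n" using Cons.prems by simp
  have P: "?P \<in> carrier_mat ?k ?k"
    using Cons.prems diag_block_mat_carrier[of "map P js" n] by auto
  have "\<forall>A \<in> set (map (\<lambda>j. c j \<cdot>\<^sub>m 1\<^sub>m n) js). A \<in> carrier_mat n n" by auto
  then have C: "?C \<in> carrier_mat ?k ?k"
    using diag_block_mat_carrier[of "map (\<lambda>j. c j \<cdot>\<^sub>m 1\<^sub>m n) js" n] unfolding length_map by blast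
  have cj: "c j \<cdot>\<^sub>m 1\<^sub>m n \<in> carrier_mat n n" by simp
  have e: "e (length js) \<in> carrier_vec ?k" unfolding e_def using x kron_ones_carrier[of "length js" n] by simp
  have ee: "e (length (j # js)) = x @\<^sub>v e (length js)"
    unfolding e_def using kron_ones_mult_vec_Suc[OF x] by simp
  have dP: "diag_block_mat (map P (j # js)) = four_block_mat (P j) (0\<^sub>m n ?k) (0\<^sub>m ?k n) ?P"
    using Pj P by (simp add: Let_def)
  have dC: "diag_block_mat (map (\<lambda>j. c j \<cdot>\<^sub>m 1\<^sub>m n) (j # js)) = four_block_mat (c j \<cdot>\<^sub>m 1\<^sub>m n) (0\<^sub>m n ?k) (0\<^sub>m ?k n) ?C"
    using C by (simp add: Let_def)
  have cx: "(c j \<cdot>\<^sub>m 1\<^sub>m n) *\<^sub>v x = c j \<cdot>\<^sub>v x" using x by (simp add: smult_one_mult_vec)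
  have "(P j *\<^sub>v (c j \<cdot>\<^sub>v x)) \<bullet> x = c j * quad_form (P j) x"
    using Pj x by (simp add: quad_form_def mult_mat_vec comm_scalar_prod[of _ n])
  moreover have "(x @\<^sub>v e (length js)) \<in> carrier_vec (n + ?k)" using x e by simp
  moreover have "P j *\<^sub>v (c j \<cdot>\<^sub>v x) \<in> carrier_vec n" "?P *\<^sub>v (?C *\<^sub>v e (length js)) \<in> carrier_vec ?k"
    using Pj x P C e by auto
  note scalar_prod_append[OF this x e]
  moreover have "?C *\<^sub>v e (length js) \<in> carrier_vec ?k" using C e by simp
  note mult_mat_vec_split[OF Pj P _ this, of "c j \<cdot>\<^sub>v x"]
  ultimately show ?case
    unfolding ee dP dC mult_mat_vec_split[OF cj C x e] cx using x Cons.IH Cons.prems by simp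
qed

text \<open>Viewing the weight blocks as positive definite lets the same inversion lemma serve for
  \<open>pi_minus\<close> as for \<open>P_minus\<close>.\<close>

lemma pos_def_mat_smult_one:
  assumes "c > 0"
  shows "pos_def_mat n (c \<cdot>\<^sub>m 1\<^sub>m n)"
  unfolding pos_def_mat_def
proof (intro conjI ballI impI)
  show "(c \<cdot>\<^sub>m 1\<^sub>m n)\<^sup>T = c \<cdot>\<^sub>m 1\<^sub>m n" by (intro eq_matI) auto
  fix x :: "real vec" assume x: "x \<in> carrier_vec n" "x \<noteq> 0\<^sub>v n"
  have "(c \<cdot>\<^sub>m 1\<^sub>m n) *\<^sub>v x = c \<cdot>\<^sub>v x" using x by (simp add: smult_one_mult_vec)
  moreover have "x \<bullet> x > 0"
  proof -
    obtain k where k: "k < n" "x $ k \<noteq> 0" using x by (metis carrier_vecD eq_vecI index_zero_vec)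
    then have "0 < \<bar>x $ k\<bar>" by simp
    also have "\<dots> \<le> norm_vec x" by (rule abs_index_le_norm_vec[OF x(1) k(1)])
    finally show ?thesis using norm_vec_power2[of x] by (metis zero_less_power)
  qed
  ultimately show "quad_form (c \<cdot>\<^sub>m 1\<^sub>m n) x > 0" using assms x by (simp add: quad_form_def)
qed simp

lemma length_others: "i \<in> {1..N} \<Longrightarrow> length (others N i) = N - 1"
proof -
  assume i: "i \<in> {1..N}"
  have d: "distinct (others N i)" by (simp add: others_def)
  have "set (others N i) = {1..N} - {i}" by (auto simp: others_def)
  then show ?thesis using distinct_card[OF d] i by simp
qed

section \<open>From the matrix inequality to the Lyapunov-Metzler inequality\<close>

lemma minv_mult_vec:
  assumes "pos_def_mat n A" "x \<in> carrier_vec n"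
  shows "minv A *\<^sub>v (A *\<^sub>v x) = x"
  using pos_def_mat_inverse[OF assms(1)] assms
  by (metis assoc_mult_mat_vec one_mult_mat_vec pos_def_mat_def)

lemma transpose_minv:
  assumes "pos_def_mat n A"
  shows "(minv A)\<^sup>T = minv A"
proof -
  note inv = pos_def_mat_inverse[OF assms]
  have A: "A \<in> carrier_mat n n" "A\<^sup>T = A" using assms by (auto simp: pos_def_mat_def)
  have "(minv A)\<^sup>T * A = 1\<^sub>m n"
    using transpose_mult[OF A(1) inv(1)] inv A by simp
  then have "(minv A)\<^sup>T * A * minv A = minv A" using inv by simp
  moreover have "(minv A)\<^sup>T * A * minv A = (minv A)\<^sup>T * (A * minv A)"
    using A inv by (intro assoc_mult_mat) auto
  ultimately show ?thesis using inv by simp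
qed

text \<open>Serves both congruences of \<open>\<Phi>\<close>: the one by \<Gamma> in the design
  inequality and the one by the stack of I and W^T in the noise set.\<close>

lemma quad_form_congruence:
  assumes "G \<in> carrier_mat r c" "\<Phi> \<in> carrier_mat c c" "z \<in> carrier_vec r"
  shows "quad_form (G * \<Phi> * G\<^sup>T) z = quad_form \<Phi> (G\<^sup>T *\<^sub>v z)"
proof -
  have "(G * \<Phi> * G\<^sup>T) *\<^sub>v z = G *\<^sub>v (\<Phi> *\<^sub>v (G\<^sup>T *\<^sub>v z))"
    using assms assoc_mult_mat_vec[of "G * \<Phi>" r c "G\<^sup>T" r z] assoc_mult_mat_vec[of G r c \<Phi> c "G\<^sup>T *\<^sub>v z"] by simp
  then show ?thesis
    unfolding quad_form_def
    using transpose_vec_mult_scalar[of G r c "\<Phi> *\<^sub>v (G\<^sup>T *\<^sub>v z)" z] assms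
    by (simp add: comm_scalar_prod[of _ c])
qed

text \<open>The noise bound is tested at v. For v = P_i x the resulting vector is the image of z
  under the transpose of \<Gamma>, so the form subtracted in the design inequality is nonnegative at
  z.\<close>

lemma noise_set_quad_form:
  assumes W: "W \<in> noise_set n T \<Phi>" and \<Phi>: "\<Phi> \<in> carrier_mat (n + T) (n + T)" and v: "v \<in> carrier_vec n"
  shows "quad_form \<Phi> (v @\<^sub>v (W\<^sup>T *\<^sub>v v)) \<ge> 0"
proof -
  have Wc: "W \<in> carrier_mat n T" using W by (simp add: noise_set_def)
  define S where "S = block_mat [[1\<^sub>m n], [W\<^sup>T]]"
  have S: "S = 1\<^sub>m n @\<^sub>r W\<^sup>T" by (simp add: S_def block_mat_def)
  have Sc: "S \<in> carrier_mat (n + T) n" unfolding S using Wc by simp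
  have Sv: "S *\<^sub>v v = v @\<^sub>v (W\<^sup>T *\<^sub>v v)"
    unfolding S using mat_mult_append[of "1\<^sub>m n" n n "W\<^sup>T" T v] Wc v by simp
  have "quad_form (S\<^sup>T * \<Phi> * S) v = quad_form \<Phi> (S *\<^sub>v v)"
    using quad_form_congruence[of "S\<^sup>T" n "n + T" \<Phi> v] Sc \<Phi> v by simp
  moreover have "quad_form (S\<^sup>T * \<Phi> * S) v \<ge> 0"
    using W v unfolding noise_set_def pos_semidef_mat_def S_def by blast
  ultimately show ?thesis using Sv by simp
qed

text \<open>
  The design inequality is evaluated at \<open>z = (- Q x, - (\<pi>\<^sub>j\<^sub>i P\<^sub>j x)\<^sub>j, P\<^sub>i x, A\<^sup>T P\<^sub>i x, B\<^sup>T P\<^sub>i x)\<close>: the last two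
  components cancel the data, leaving \<open>\<Gamma>\<^sup>T z = (P\<^sub>i x, W\<^sup>T P\<^sub>i x)\<close>, and the first two complete the squares.
\<close>

lemma design_mat_imp_Lyapunov_Metzler:
  assumes i: "i \<in> {1..N}"
    and A: "A \<in> carrier_mat n n" and B: "B \<in> carrier_mat n m"
    and X: "X \<in> carrier_mat n T" and Xdot: "Xdot \<in> carrier_mat n T" and U: "U \<in> carrier_mat m T"
    and \<Phi>: "\<Phi> \<in> carrier_mat (n + T) (n + T)"
    and W: "W \<in> noise_set n T \<Phi>" "Xdot = A * X + B * U + W"
    and P: "\<And>j. j \<in> {1..N} \<Longrightarrow> pos_def_mat n (P j)"
    and \<alpha>: "\<alpha> \<ge> 0" and L: "L \<in> carrier_mat m n" and Q: "pos_def_mat n Q" and \<pi>: "\<pi> \<in> M_plus N"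
    and psd: "pos_semidef_mat (n + (N - 1) * n + n + n + m)
      (design_mat n m N P \<pi> Q L i - \<alpha> \<cdot>\<^sub>m (Gamma_mat n m N T X Xdot U * \<Phi> * (Gamma_mat n m N T X Xdot U)\<^sup>T))"
    and x: "x \<in> carrier_vec n"
  shows "2 * (((A + B * (L * P i)) *\<^sub>v x) \<bullet> (P i *\<^sub>v x)) \<le>
    - quad_form Q x - (\<Sum>j\<in>{1..N}. \<pi> j i * quad_form (P j) x)"
proof -
  define k where "k = (N - 1) * n"
  define R where "R = minv (P i)"
  define E where "E = kron (ones_col (N - 1)) (1\<^sub>m n)"
  define PM where "PM = P_minus N P i"
  define CM where "CM = pi_minus n N \<pi> i"
  define \<Gamma> where "\<Gamma> = Gamma_mat n m N T X Xdot U"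
  have Pi: "pos_def_mat n (P i)" using P i by simp
  have Pc: "P i \<in> carrier_mat n n" and Pt: "(P i)\<^sup>T = P i" and Qc: "Q \<in> carrier_mat n n"
    using Pi Q by (auto simp: pos_def_mat_def)
  have Wc: "W \<in> carrier_mat n T" using W by (simp add: noise_set_def)
  have R: "R \<in> carrier_mat n n" "R\<^sup>T = R"
    using pos_def_mat_inverse[OF Pi] transpose_minv[OF Pi] by (auto simp: R_def)
  have E: "E \<in> carrier_mat k n" using kron_ones_carrier by (simp add: E_def k_def)
  have so: "set (others N i) = {1..N} - {i}" by (auto simp: others_def)
  have "\<forall>M \<in> set (map P (others N i)). pos_def_mat n M" using P so by auto
  then have PM: "pos_def_mat k PM"
    using pos_def_mat_diag_block[of "map P (others N i)" n]
    unfolding length_map length_others[OF i] PM_def P_minus_def k_def by blast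
  have "\<forall>M \<in> set (map (\<lambda>j. \<pi> j i \<cdot>\<^sub>m 1\<^sub>m n) (others N i)). pos_def_mat n M"
    using so \<pi> i by (auto simp: M_plus_def intro!: pos_def_mat_smult_one)
  then have CM: "pos_def_mat k CM"
    using pos_def_mat_diag_block[of "map (\<lambda>j. \<pi> j i \<cdot>\<^sub>m 1\<^sub>m n) (others N i)" n]
    unfolding length_map length_others[OF i] CM_def pi_minus_def k_def by blast
  have PMc: "PM \<in> carrier_mat k k" and CMc: "CM \<in> carrier_mat k k" using PM CM by (auto simp: pos_def_mat_def)
  define y where "y = P i *\<^sub>v x"
  define e where "e = E *\<^sub>v x"
  \<comment> \<open>The block \<open>S2\<close> below undoes \<open>PM\<close> and then
    \<open>CM\<close>, so it returns w to e, just as \<open>minv Q\<close> returns Q x to x.\<close>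
  define w where "w = PM *\<^sub>v (CM *\<^sub>v e)"
  have y: "y \<in> carrier_vec n" using Pc x by (simp add: y_def)
  have Ry: "R *\<^sub>v y = x" unfolding R_def y_def by (rule minv_mult_vec[OF Pi x])
  have e: "e \<in> carrier_vec k" using E x by (simp add: e_def)
  have w: "w \<in> carrier_vec k" using PMc CMc e by (simp add: w_def)
  have Qx: "Q *\<^sub>v x \<in> carrier_vec n" using Qc x by simp
  have weight: "w \<bullet> e = (\<Sum>j\<in>{1..N} - {i}. \<pi> j i * quad_form (P j) x)"
  proof -
    have "w \<bullet> e = (\<Sum>j\<leftarrow>others N i. \<pi> j i * quad_form (P j) x)"
      using diag_block_mat_weighted_sum[of "others N i" P n x "\<lambda>j. \<pi> j i"] P so x length_others[OF i]
      by (auto simp: w_def e_def E_def PM_def CM_def P_minus_def pi_minus_def pos_def_mat_def)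
    also have "\<dots> = (\<Sum>j\<in>{1..N} - {i}. \<pi> j i * quad_form (P j) x)"
      unfolding so[symmetric] by (intro sum_list_distinct_conv_sum_set) (simp add: others_def)
    finally show ?thesis .
  qed
  define z where "z = (- (Q *\<^sub>v x)) @\<^sub>v (- w) @\<^sub>v y @\<^sub>v (A\<^sup>T *\<^sub>v y) @\<^sub>v (B\<^sup>T *\<^sub>v y)"
  have zs: "- (Q *\<^sub>v x) \<in> carrier_vec n" "- w \<in> carrier_vec k" "A\<^sup>T *\<^sub>v y \<in> carrier_vec n" "B\<^sup>T *\<^sub>v y \<in> carrier_vec m"
    using Qx w A B y by auto
  have z: "z \<in> carrier_vec (n + (k + (n + (n + m))))" unfolding z_def using zs y by simp
  have \<Gamma>: "\<Gamma> \<in> carrier_mat (n + (k + (n + (n + m)))) (n + T)"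
    unfolding \<Gamma>_def k_def by (rule Gamma_mat_carrier[OF X Xdot U])
  define D where "D = design_mat n m N P \<pi> Q L i"
  define S2 where "S2 = minv CM * minv PM"
  have S2: "S2 \<in> carrier_mat k k" unfolding S2_def using pos_def_mat_inverse(1) PM CM by (metis mult_carrier_mat)
  have S1: "minv Q \<in> carrier_mat n n" by (rule pos_def_mat_inverse[OF Q])
  have ER: "E * R \<in> carrier_mat k n" "R * E\<^sup>T \<in> carrier_mat n k" "- \<pi> i i \<cdot>\<^sub>m R \<in> carrier_mat n n" using E R by auto
  have D_eq: "D = block_mat
      [[minv Q, 0\<^sub>m n k, R, 0\<^sub>m n n, 0\<^sub>m n m],
       [0\<^sub>m k n, S2, E * R, 0\<^sub>m k n, 0\<^sub>m k m],
       [R, R * E\<^sup>T, - \<pi> i i \<cdot>\<^sub>m R, - R, - L\<^sup>T],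
       [0\<^sub>m n n, 0\<^sub>m n k, - R, 0\<^sub>m n n, 0\<^sub>m n m],
       [0\<^sub>m m n, 0\<^sub>m m k, - L, 0\<^sub>m m n, 0\<^sub>m m m]]"
    unfolding D_def design_mat_def Let_def S2_def CM_def PM_def E_def R_def k_def ..
  note block = quad_form_block_mat5[OF S1 S2 R(1) ER L zs(1,2) y zs(3,4), folded D_eq z_def]
  have neg: "M *\<^sub>v (- v) = - (M *\<^sub>v v)" if "M \<in> carrier_mat r c" "v \<in> carrier_vec c" for M :: "real mat" and r c v
    using that by (intro eq_vecI) (auto simp: scalar_prod_def sum_negf)
  have nl: "(- u) \<bullet> v = - (u \<bullet> v)" "u \<bullet> (- v) = - (u \<bullet> v)" if "u \<in> carrier_vec r" "v \<in> carrier_vec r" for u v :: "real vec" and r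
    using that by (auto simp: scalar_prod_def sum_negf)
  have S2w: "S2 *\<^sub>v w = e"
  proof -
    have "S2 *\<^sub>v w = minv CM *\<^sub>v (minv PM *\<^sub>v (PM *\<^sub>v (CM *\<^sub>v e)))"
      unfolding S2_def w_def using pos_def_mat_inverse(1)[OF PM] pos_def_mat_inverse(1)[OF CM] w
      by (intro assoc_mult_mat_vec) (auto simp: w_def)
    then show ?thesis using minv_mult_vec[OF PM] minv_mult_vec[OF CM] CMc e by simp
  qed
  have adj: "(M *\<^sub>v u) \<bullet> v = u \<bullet> (M\<^sup>T *\<^sub>v v)"
    if "M \<in> carrier_mat r c" "u \<in> carrier_vec c" "v \<in> carrier_vec r" for M :: "real mat" and u v r c
    using transpose_vec_mult_scalar[OF that] that by (simp add: comm_scalar_prod[of _ c] comm_scalar_prod[of _ r])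
  define q where "q = quad_form Q x"
  define a where "a = (A *\<^sub>v x) \<bullet> y"
  define b where "b = ((B * (L * P i)) *\<^sub>v x) \<bullet> y"
  have t1: "(- (Q *\<^sub>v x)) \<bullet> (minv Q *\<^sub>v (- (Q *\<^sub>v x))) = q"
    unfolding neg[OF S1 Qx] minv_mult_vec[OF Q x] q_def quad_form_def
    using nl(1)[OF Qx, of "- x"] nl(2)[OF Qx x] x comm_scalar_prod[OF Qx x] by simp
  have t2: "(- w) \<bullet> (S2 *\<^sub>v (- w)) = w \<bullet> e"
    unfolding neg[OF S2 w] S2w using nl(1)[OF w, of "- e"] nl(2)[OF w e] e by simp
  have t3: "y \<bullet> ((- \<pi> i i \<cdot>\<^sub>m R) *\<^sub>v y) = - \<pi> i i * quad_form (P i) x"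
  proof -
    have "(- \<pi> i i \<cdot>\<^sub>m R) *\<^sub>v y = - \<pi> i i \<cdot>\<^sub>v x"
      using R y Ry by (intro eq_vecI) (auto simp: row_smult)
    then show ?thesis using x y by (simp add: quad_form_def y_def comm_scalar_prod[of _ n])
  qed
  have t4: "(- (Q *\<^sub>v x)) \<bullet> (R *\<^sub>v y) = - q" "y \<bullet> (R *\<^sub>v (- (Q *\<^sub>v x))) = - q"
  proof -
    show 1: "(- (Q *\<^sub>v x)) \<bullet> (R *\<^sub>v y) = - q"
      unfolding Ry nl(1)[OF Qx x] q_def quad_form_def comm_scalar_prod[OF Qx x] ..
    show "y \<bullet> (R *\<^sub>v (- (Q *\<^sub>v x))) = - q"
      using adj[OF R(1) y zs(1)] 1 unfolding R(2) Ry comm_scalar_prod[OF x zs(1)] by simp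
  qed
  have t5: "(- w) \<bullet> ((E * R) *\<^sub>v y) = - (w \<bullet> e)"
    unfolding assoc_mult_mat_vec[OF E R(1) y] Ry e_def[symmetric] by (rule nl(1)[OF w e])
  have t6: "y \<bullet> ((R * E\<^sup>T) *\<^sub>v (- w)) = - (w \<bullet> e)"
  proof -
    have "y \<bullet> ((R * E\<^sup>T) *\<^sub>v (- w)) = y \<bullet> (R\<^sup>T *\<^sub>v (E\<^sup>T *\<^sub>v (- w)))"
      using assoc_mult_mat_vec[OF R(1) _ zs(2), of "E\<^sup>T"] E R by simp
    also have "\<dots> = x \<bullet> (E\<^sup>T *\<^sub>v (- w))" using adj[OF R(1) y, of "E\<^sup>T *\<^sub>v (- w)"] E w Ry by simp
    also have "\<dots> = e \<bullet> (- w)" unfolding e_def by (rule adj[OF E x zs(2), symmetric])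
    finally show ?thesis unfolding nl(2)[OF e w] comm_scalar_prod[OF e w] .
  qed
  have t7: "y \<bullet> (R *\<^sub>v (A\<^sup>T *\<^sub>v y)) = a" "(A\<^sup>T *\<^sub>v y) \<bullet> (R *\<^sub>v y) = a"
  proof -
    have "y \<bullet> (R *\<^sub>v (A\<^sup>T *\<^sub>v y)) = x \<bullet> (A\<^sup>T *\<^sub>v y)"
      using adj[OF R(1) y zs(3)] R Ry by simp
    also have "\<dots> = a" unfolding a_def by (rule adj[OF A x y, symmetric])
    finally show 1: "y \<bullet> (R *\<^sub>v (A\<^sup>T *\<^sub>v y)) = a" .
    show "(A\<^sup>T *\<^sub>v y) \<bullet> (R *\<^sub>v y) = a"
      unfolding Ry a_def adj[OF A x y] by (rule comm_scalar_prod[OF zs(3) x])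
  qed
  have Ly: "L *\<^sub>v y \<in> carrier_vec m" using L y by simp
  have t8: "y \<bullet> (L\<^sup>T *\<^sub>v (B\<^sup>T *\<^sub>v y)) = b" "(B\<^sup>T *\<^sub>v y) \<bullet> (L *\<^sub>v y) = b"
  proof -
    have "b = (B *\<^sub>v (L *\<^sub>v y)) \<bullet> y"
      unfolding b_def y_def
      using assoc_mult_mat_vec[OF B mult_carrier_mat[OF L Pc] x] assoc_mult_mat_vec[OF L Pc x] by simp
    also have "\<dots> = (L *\<^sub>v y) \<bullet> (B\<^sup>T *\<^sub>v y)" by (rule adj[OF B Ly y])
    finally have 1: "b = (L *\<^sub>v y) \<bullet> (B\<^sup>T *\<^sub>v y)" .
    show "y \<bullet> (L\<^sup>T *\<^sub>v (B\<^sup>T *\<^sub>v y)) = b" unfolding 1 by (rule adj[OF L y zs(4), symmetric])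
    show "(B\<^sup>T *\<^sub>v y) \<bullet> (L *\<^sub>v y) = b" unfolding 1 by (rule comm_scalar_prod[OF zs(4) Ly])
  qed
  \<comment> \<open>Each square enters once with a plus (\<open>t1\<close>, \<open>t2\<close>) and
    each matching cross term twice with a minus (\<open>t4\<close> to \<open>t6\<close>), so one
    negative copy of q and of \<open>w \<bullet> e\<close> remains.\<close>
  have quadD: "quad_form D z = - q - w \<bullet> e - \<pi> i i * quad_form (P i) x - 2 * a - 2 * b"
    unfolding block(2) t1 t2 t3 t4 t5 t6 t7 t8 by simp
  have \<Gamma>z: "\<Gamma>\<^sup>T *\<^sub>v z = y @\<^sub>v (W\<^sup>T *\<^sub>v y)"
  proof -
    have "Xdot\<^sup>T *\<^sub>v y - (X\<^sup>T *\<^sub>v (A\<^sup>T *\<^sub>v y) + U\<^sup>T *\<^sub>v (B\<^sup>T *\<^sub>v y)) = W\<^sup>T *\<^sub>v y"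
    proof -
      have "Xdot\<^sup>T = X\<^sup>T * A\<^sup>T + U\<^sup>T * B\<^sup>T + W\<^sup>T"
        unfolding W(2) using A B X U Wc
        by (simp add: transpose_add[of _ n T] transpose_mult[of _ n n _ T] transpose_mult[of _ n m _ T])
      then have "Xdot\<^sup>T *\<^sub>v y = X\<^sup>T *\<^sub>v (A\<^sup>T *\<^sub>v y) + U\<^sup>T *\<^sub>v (B\<^sup>T *\<^sub>v y) + W\<^sup>T *\<^sub>v y"
        using A B X U Wc y
        by (simp add: add_mult_distrib_mat_vec[of _ T n] assoc_mult_mat_vec[of _ T n _ n] assoc_mult_mat_vec[of _ T m _ n])
      then show ?thesis using A B X U Wc y by (intro eq_vecI) auto
    qed
    then show ?thesis
      using transpose_Gamma_mat_mult_vec[OF X Xdot U zs(1) zs(2)[unfolded k_def] y zs(3,4)]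
      by (simp add: \<Gamma>_def z_def)
  qed
  have "quad_form (D - \<alpha> \<cdot>\<^sub>m (\<Gamma> * \<Phi> * \<Gamma>\<^sup>T)) z \<ge> 0"
    using psd z unfolding pos_semidef_mat_def D_def \<Gamma>_def k_def by (simp add: add.assoc)
  moreover have "quad_form (D - \<alpha> \<cdot>\<^sub>m (\<Gamma> * \<Phi> * \<Gamma>\<^sup>T)) z = quad_form D z - \<alpha> * quad_form (\<Gamma> * \<Phi> * \<Gamma>\<^sup>T) z"
  proof -
    let ?d = "n + (k + (n + (n + m)))"
    define M where "M = \<Gamma> * \<Phi> * \<Gamma>\<^sup>T"
    have M: "M \<in> carrier_mat ?d ?d" using \<Gamma> \<Phi> by (simp add: M_def)
    have "(\<alpha> \<cdot>\<^sub>m M) *\<^sub>v z = \<alpha> \<cdot>\<^sub>v (M *\<^sub>v z)" using M z by (intro eq_vecI) (auto simp: row_smult)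
    then have "(D - \<alpha> \<cdot>\<^sub>m M) *\<^sub>v z = D *\<^sub>v z - \<alpha> \<cdot>\<^sub>v (M *\<^sub>v z)"
      using block(1) M z by (simp add: minus_mult_distrib_mat_vec[of _ ?d ?d])
    moreover have "D *\<^sub>v z \<in> carrier_vec ?d" "M *\<^sub>v z \<in> carrier_vec ?d" using block(1) M z by auto
    ultimately show ?thesis unfolding M_def[symmetric] quad_form_def
      using z by (simp add: scalar_prod_minus_distrib[of _ ?d])
  qed
  moreover have "quad_form (\<Gamma> * \<Phi> * \<Gamma>\<^sup>T) z \<ge> 0"
    unfolding quad_form_congruence[OF \<Gamma> \<Phi> z] \<Gamma>z by (rule noise_set_quad_form[OF W(1) \<Phi> y])
  ultimately have "quad_form D z \<ge> 0" using \<alpha> by (metis diff_ge_0_iff_ge mult_nonneg_nonneg order_trans)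
  \<comment> \<open>The summand j = i comes from the third diagonal block of the design matrix, the
    others from the completed square in w.\<close>
  moreover have "(\<Sum>j\<in>{1..N}. \<pi> j i * quad_form (P j) x) = \<pi> i i * quad_form (P i) x + w \<bullet> e"
    unfolding weight using i by (intro sum.remove) auto
  moreover have "((A + B * (L * P i)) *\<^sub>v x) \<bullet> (P i *\<^sub>v x) = a + b"
  proof -
    have "B * (L * P i) \<in> carrier_mat n n" using B L Pc by simp
    then show ?thesis unfolding a_def b_def y_def[symmetric]
      using A x y by (simp add: add_mult_distrib_mat_vec[of _ n n] add_scalar_prod_distrib[of _ n])
  qed
  ultimately show ?thesis using quadD by (simp add: q_def)
qed

section \<open>Monotonicity from a Dini estimate off a null set\<close>

lemma sum_length_division_le:
  fixes S :: "real set"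
  assumes d: "d division_of S" and D: "S \<subseteq> D" "D \<in> lmeasurable"
  shows "(\<Sum>k\<in>d. Sup k - Inf k) \<le> measure lebesgue D"
proof -
  have "((\<lambda>_. 1::real) has_integral Sup k - Inf k) k" if "k \<in> d" for k
  proof -
    obtain u v where "k = cbox u v" "k \<noteq> {}" using division_ofD[OF d] \<open>k \<in> d\<close> by metis
    then show ?thesis using has_integral_const_real[of "1::real" u v] by auto
  qed
  \<comment> \<open>Members of a division have disjoint interiors, so the total length is the
    integral of 1 over S, that is, the measure of S.\<close>
  then have "((\<lambda>_. 1::real) has_integral (\<Sum>k\<in>d. Sup k - Inf k)) S"
    by (intro has_integral_combine_division[OF d])
  moreover have "compact S" using division_ofD(1,4,6)[OF d] compact_Union by (metis compact_cbox)
  ultimately have "(\<Sum>k\<in>d. Sup k - Inf k) = measure lebesgue S"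
    using lmeasure_integral[of S] lmeasurable_compact by (metis integral_unique)
  also have "\<dots> \<le> measure lebesgue D"
    using D \<open>compact S\<close> by (intro measure_mono_fmeasurable) (auto simp: fmeasurableD lmeasurable_compact)
  finally show ?thesis .
qed

lemma negligible_outer_open_small:
  fixes E :: "real set"
  assumes "negligible E" "e > 0"
  obtains D where "open D" "E \<subseteq> D" "D \<in> lmeasurable" "measure lebesgue D < e"
proof -
  have E: "E \<in> lmeasurable" "measure lebesgue E = 0"
    using assms(1) by (simp_all add: negligible_imp_measurable negligible_imp_measure0)
  obtain D where D: "open D" "E \<subseteq> D" "D - E \<in> lmeasurable" "emeasure lebesgue (D - E) < ennreal e"
    using sets_lebesgue_outer_open[OF fmeasurableD[OF E(1)] assms(2)] by blast
  have "D = E \<union> (D - E)" using D(2) by blast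
  then have m: "D \<in> lmeasurable" "measure lebesgue D \<le> measure lebesgue E + measure lebesgue (D - E)"
    using E(1) D(3) by (metis fmeasurable.Un, metis measure_Un_le fmeasurableD)
  have "measure lebesgue (D - E) < e"
    using D(4) assms(2) emeasure_eq_measure2[OF D(3)] by (simp add: ennreal_less_iff)
  with m E that D show ?thesis by force
qed

text \<open>
  The points of the exceptional null set are crossed inside an open set \<open>D\<close> of small measure, where
  absolute continuity bounds the variation \<open>V\<close>; elsewhere \<open>g\<close> grows with slope at most \<open>e\<close>.
\<close>

lemma abs_continuous_right_Dini_nonincreasing:
  fixes g :: "real \<Rightarrow> real"
  assumes ab: "a \<le> b"
    and ac: "\<And>e. e > 0 \<Longrightarrow> \<exists>\<delta>>0. \<forall>d S. d division_of S \<and> S \<subseteq> {a..b} \<and> (\<Sum>k\<in>d. Sup k - Inf k) < \<delta> \<longrightarrow>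
        (\<Sum>k\<in>d. \<bar>g (Sup k) - g (Inf k)\<bar>) < e"
    and E: "negligible E"
    and dini: "\<And>t e. a \<le> t \<Longrightarrow> t < b \<Longrightarrow> t \<notin> E \<Longrightarrow> e > 0 \<Longrightarrow>
        \<exists>h>0. \<forall>s. t \<le> s \<and> s \<le> t + h \<longrightarrow> g s - g t \<le> e * (s - t)"
  shows "g b \<le> g a"
proof -
  have main: "g b - g a \<le> e * (b - a) + e" if e: "e > 0" for e
  proof -
    obtain \<delta> where "\<delta> > 0" and \<delta>: "\<And>d S. d division_of S \<Longrightarrow> S \<subseteq> {a..b} \<Longrightarrow> (\<Sum>k\<in>d. Sup k - Inf k) < \<delta> \<Longrightarrow>
        (\<Sum>k\<in>d. \<bar>g (Sup k) - g (Inf k)\<bar>) < e"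
      using ac[OF e] by metis
    obtain D where "open D" "E \<subseteq> D" and D: "D \<in> lmeasurable" "measure lebesgue D < \<delta>"
      using negligible_outer_open_small[OF E \<open>\<delta> > 0\<close>] by blast
    define vars where "vars c = {\<Sum>k\<in>d. \<bar>g (Sup k) - g (Inf k)\<bar> | d. \<exists>S. d division_of S \<and> S \<subseteq> D \<inter> {a..c}}" for c
    define V where "V c = Sup (vars c)" for c
    \<comment> \<open>A division inside D has total length at most the measure of D, hence below
      \<delta>, so absolute continuity caps its sum by e.\<close>
    have bound: "v \<le> e" if "v \<in> vars c" "c \<le> b" for v c
    proof -
      obtain d S where v: "v = (\<Sum>k\<in>d. \<bar>g (Sup k) - g (Inf k)\<bar>)" and d: "d division_of S" "S \<subseteq> D" "S \<subseteq> {a..c}"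
        using \<open>v \<in> vars c\<close> unfolding vars_def by blast
      have "(\<Sum>k\<in>d. Sup k - Inf k) < \<delta>"
        using sum_length_division_le[OF d(1,2) D(1)] D(2) by linarith
      moreover have "S \<subseteq> {a..b}" using d(3) \<open>c \<le> b\<close> by auto
      ultimately show ?thesis using \<delta>[OF d(1)] v by force
    qed
    have zero: "0 \<in> vars c" for c
      unfolding vars_def by (auto intro!: exI[of _ "{}"])
    have bdd: "bdd_above (vars c)" if "c \<le> b" for c
      using bound that unfolding bdd_above_def by blast
    have V_mono: "V c \<le> V c'" if "c \<le> c'" "c' \<le> b" for c c'
      unfolding V_def
    proof (rule cSup_subset_mono)
      show "vars c \<noteq> {}" using zero by blast
      show "bdd_above (vars c')" using bdd that by simp
      have "D \<inter> {a..c} \<subseteq> D \<inter> {a..c'}" using that by auto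
      then show "vars c \<subseteq> vars c'" unfolding vars_def by blast
    qed
    have V_step: "V c + \<bar>g c' - g c\<bar> \<le> V c'" if cc: "a \<le> c" "c < c'" "c' \<le> b" "{c..c'} \<subseteq> D" for c c'
    proof -
      have "v + \<bar>g c' - g c\<bar> \<in> vars c'" if "v \<in> vars c" for v
      proof -
        obtain d S where v: "v = (\<Sum>k\<in>d. \<bar>g (Sup k) - g (Inf k)\<bar>)" and d: "d division_of S" "S \<subseteq> D" "S \<subseteq> {a..c}"
          using \<open>v \<in> vars c\<close> unfolding vars_def by blast
        \<comment> \<open>The new interval is appended to a division living left of c: interiors are
          disjoint, and since c' > c it is not yet a member, so the sum really gains a term.\<close>
        have I: "{{c..c'}} division_of {c..c'}" using division_of_self[of c c'] cc(2) by simp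
        have "interior S \<inter> interior {c..c'} = {}"
          using interior_mono[OF d(3)] by auto
        then have "(d \<union> {{c..c'}}) division_of (S \<union> {c..c'})" by (rule division_disjoint_union[OF d(1) I])
        moreover have "S \<union> {c..c'} \<subseteq> D \<inter> {a..c'}" using d cc by auto
        moreover have "{c..c'} \<notin> d" 
        proof
          assume "{c..c'} \<in> d"
          then have "{c..c'} \<subseteq> S" using division_ofD(2)[OF d(1)] by blast
          then have "c' \<in> S" using cc by auto
          then show False using d(3) cc by auto
        qed
        then have "v + \<bar>g c' - g c\<bar> = (\<Sum>k\<in>d \<union> {{c..c'}}. \<bar>g (Sup k) - g (Inf k)\<bar>)"
          using division_of_finite[OF d(1)] v cc(2) by simp
        ultimately show ?thesis unfolding vars_def by blast
      qed
      then have "v \<le> V c' - \<bar>g c' - g c\<bar>" if "v \<in> vars c" for v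
        using cSup_upper[OF _ bdd[OF cc(3)]] that unfolding V_def by force
      then have "V c \<le> V c' - \<bar>g c' - g c\<bar>"
        unfolding V_def[of c] using zero by (intro cSup_least) auto
      then show ?thesis by simp
    qed
    \<comment> \<open>Induction along the interval: Z contains a, contains its supremum, and no
      point below b can be that supremum.\<close>
    define Z where "Z = {c. a \<le> c \<and> c \<le> b \<and> g c - g a \<le> e * (c - a) + V c}"
    define s where "s = Sup Z"
    have "a \<in> Z" using ab cSup_upper[OF zero bdd[OF ab]] by (simp add: Z_def V_def)
    have Zb: "bdd_above Z" unfolding bdd_above_def Z_def by auto
    have as: "a \<le> s" unfolding s_def using \<open>a \<in> Z\<close> Zb by (rule cSup_upper)
    have sb: "s \<le> b" unfolding s_def using \<open>a \<in> Z\<close> by (intro cSup_least) (auto simp: Z_def)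
    \<comment> \<open>V is only known to be monotone, but the approximating points of Z lie left of
      s, where monotonicity has the right direction; only g needs continuity.\<close>
    have "g s - g a \<le> e * (s - a) + V s"
    proof (rule field_le_epsilon)
      fix \<eta> :: real assume "\<eta> > 0"
      then obtain \<gamma> where "\<gamma> > 0" and \<gamma>: "\<And>d S. d division_of S \<Longrightarrow> S \<subseteq> {a..b} \<Longrightarrow> (\<Sum>k\<in>d. Sup k - Inf k) < \<gamma> \<Longrightarrow>
          (\<Sum>k\<in>d. \<bar>g (Sup k) - g (Inf k)\<bar>) < \<eta>"
        using ac by metis
      obtain c where c: "c \<in> Z" "s - \<gamma> < c"
        using less_cSupD[of Z "s - \<gamma>"] \<open>a \<in> Z\<close> \<open>\<gamma> > 0\<close> unfolding s_def by auto
      have "c \<le> s" unfolding s_def using c(1) Zb by (rule cSup_upper)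
      have "\<bar>g s - g c\<bar> < \<eta>"
        using \<gamma>[of "{{c..s}}" "{c..s}"] division_of_self[of c s] \<open>c \<le> s\<close> c sb by (auto simp: Z_def)
      moreover have "g c - g a \<le> e * (c - a) + V c" using c(1) by (simp add: Z_def)
      moreover have "V c \<le> V s" using V_mono \<open>c \<le> s\<close> sb by blast
      moreover have "e * (c - a) \<le> e * (s - a)" using \<open>c \<le> s\<close> e by simp
      ultimately show "g s - g a \<le> e * (s - a) + V s + \<eta>" by linarith
    qed
    moreover have "s = b"
    proof (rule ccontr)
      assume "s \<noteq> b"
      then have "s < b" using sb by simp
      have "\<exists>s'. s < s' \<and> s' \<le> b \<and> g s' - g s \<le> e * (s' - s) + (V s' - V s)"
      proof (cases "s \<in> E")
        case True
        then have "s \<in> D" using \<open>E \<subseteq> D\<close> by blast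
        then obtain r where "r > 0" "cball s r \<subseteq> D" using \<open>open D\<close> open_contains_cball by blast
        define s' where "s' = min b (s + r)"
        have s': "s < s'" "s' \<le> b" using \<open>s < b\<close> \<open>r > 0\<close> by (auto simp: s'_def)
        have "{s..s'} \<subseteq> cball s r" by (auto simp: s'_def dist_real_def)
        then have "V s + \<bar>g s' - g s\<bar> \<le> V s'" using V_step as s' \<open>cball s r \<subseteq> D\<close> by blast
        moreover have "e * (s' - s) \<ge> 0" using e s' by simp
        ultimately have "g s' - g s \<le> e * (s' - s) + (V s' - V s)" by linarith
        with s' show ?thesis by blast
      next
        case False
        then obtain h where "h > 0" and h: "\<And>s'. s \<le> s' \<Longrightarrow> s' \<le> s + h \<Longrightarrow> g s' - g s \<le> e * (s' - s)"
          using dini[OF as \<open>s < b\<close> False e] by blast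
        define s' where "s' = min b (s + h)"
        have s': "s < s'" "s' \<le> b" using \<open>s < b\<close> \<open>h > 0\<close> by (auto simp: s'_def)
        have "g s' - g s \<le> e * (s' - s)" using h[of s'] s' by (simp add: s'_def)
        moreover have "V s \<le> V s'" using V_mono s' by simp
        ultimately have "g s' - g s \<le> e * (s' - s) + (V s' - V s)" by linarith
        with s' show ?thesis by blast
      qed
      then obtain s' where s': "s < s'" "s' \<le> b" "g s' - g s \<le> e * (s' - s) + (V s' - V s)" by blast
      have "e * (s' - a) = e * (s' - s) + e * (s - a)" by (simp add: algebra_simps)
      then have "s' \<in> Z" using s' as \<open>g s - g a \<le> e * (s - a) + V s\<close> by (simp add: Z_def)
      then have "s' \<le> s" unfolding s_def using Zb by (intro cSup_upper)
      then show False using s' by simp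
    qed
    moreover have "V b \<le> e" unfolding V_def using zero bound by (intro cSup_least) auto
    ultimately show ?thesis by simp
  qed
  show ?thesis
  proof (rule field_le_epsilon)
    fix \<eta> :: real assume "\<eta> > 0"
    \<comment> \<open>Slope e and budget e give the total error \<open>e * (b - a + 1)\<close>,
      whence the divisor.\<close>
    then have "\<eta> / (b - a + 1) > 0" using ab by simp
    then have "g b - g a \<le> \<eta> / (b - a + 1) * (b - a) + \<eta> / (b - a + 1)" by (rule main)
    also have "\<dots> = \<eta> / (b - a + 1) * (b - a + 1)" by (simp only: distrib_left mult_1_right)
    also have "\<dots> = \<eta>" using ab by simp
    finally show "g b \<le> g a + \<eta>" by simp
  qed
qed

section \<open>The switching law and its active modes\<close>

lemma switching_law_minimizes:
  assumes "N \<ge> 1"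
  shows "switching_law N P x \<in> {1..N}"
    and "j \<in> {1..N} \<Longrightarrow> quad_form (P (switching_law N P x)) x \<le> quad_form (P j) x"
proof -
  let ?f = "\<lambda>i. quad_form (P i) x"
  let ?S = "{i. is_arg_min ?f (\<lambda>i. i \<in> {1..N}) i}"
  have "?S \<subseteq> {1..N}" by (auto simp: is_arg_min_def)
  then have "finite ?S" by (rule finite_subset) simp
  moreover have "?S \<noteq> {}" using ex_is_arg_min_if_finite[of "{1..N}" ?f] assms by auto
  ultimately have "switching_law N P x \<in> ?S" unfolding switching_law_def by (rule Min_in)
  then show "switching_law N P x \<in> {1..N}" "j \<in> {1..N} \<Longrightarrow> ?f (switching_law N P x) \<le> ?f j"
    by (auto simp: is_arg_min_linorder)
qed

text \<open>Points arbitrarily close to x select mode i, and there form i is minimal; the comparison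
  survives the limit. The limit is taken quantitatively, by contradicting a positive gap at
  x.\<close>

lemma active_mode_minimizes:
  assumes N: "N \<ge> 1" and P: "\<And>i. i \<in> {1..N} \<Longrightarrow> P i \<in> carrier_mat n n"
    and x: "x \<in> carrier_vec n" and i: "i \<in> active_modes n N (switching_law N P) x" and j: "j \<in> {1..N}"
  shows "quad_form (P i) x \<le> quad_form (P j) x"
proof (rule ccontr)
  assume neg: "\<not> ?thesis"
  define gap where "gap = quad_form (P i) x - quad_form (P j) x"
  have gap: "gap > 0" using neg by (simp add: gap_def)
  have iN: "i \<in> {1..N}" using i by (simp add: active_modes_def)
  obtain C where C: "C > 0" "\<And>x y. x \<in> carrier_vec n \<Longrightarrow> y \<in> carrier_vec n \<Longrightarrow>
      \<bar>quad_form (P i) y - quad_form (P i) x\<bar> \<le> C * norm_vec (y - x) * (norm_vec x + norm_vec y)"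
    using quad_form_diff_bound[OF P[OF iN]] by blast
  obtain C' where C': "C' > 0" "\<And>x y. x \<in> carrier_vec n \<Longrightarrow> y \<in> carrier_vec n \<Longrightarrow>
      \<bar>quad_form (P j) y - quad_form (P j) x\<bar> \<le> C' * norm_vec (y - x) * (norm_vec x + norm_vec y)"
    using quad_form_diff_bound[OF P[OF j]] by blast
  \<comment> \<open>Within distance 1 of x the two norms add up to at most
    \<open>2 * norm_vec x + 1\<close>, so K bounds the rate at which the gap between the two forms
    can close.\<close>
  define K where "K = (C + C') * (2 * norm_vec x + 1)"
  have K: "K > 0" using C(1) C'(1) by (simp add: K_def add_nonneg_pos)
  have "min 1 (gap / K) > 0" using gap K by simp
  then obtain y where y: "y \<in> mode_region n (switching_law N P) i" "norm_vec (y - x) < min 1 (gap / K)"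
    using i unfolding active_modes_def by blast
  have yc: "y \<in> carrier_vec n" and "switching_law N P y = i" using y(1) by (auto simp: mode_region_def)
  then have "quad_form (P i) y \<le> quad_form (P j) y" using switching_law_minimizes(2)[OF N j, of P y] by simp
  then have "gap \<le> (C + C') * norm_vec (y - x) * (norm_vec x + norm_vec y)"
    using C(2)[OF x yc] C'(2)[OF x yc] by (simp add: gap_def algebra_simps)
  also have "\<dots> \<le> (C + C') * norm_vec (y - x) * (2 * norm_vec x + 1)"
    using norm_vec_le_add_norm_diff[OF x yc] y(2) C(1) C'(1) by (intro mult_left_mono) auto
  also have "\<dots> = K * norm_vec (y - x)" by (simp add: K_def)
  also have "\<dots> < gap" using y(2) K by (simp add: field_simps)
  finally show False by simp
qed

section \<open>Quadratic forms along trajectories\<close>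

lemma quad_form_eq_sum:
  assumes "A \<in> carrier_mat n n" "x \<in> carrier_vec n"
  shows "quad_form A x = (\<Sum>i<n. \<Sum>j<n. x $ i * A $$ (i, j) * x $ j)"
  using assms by (auto simp: quad_form_def scalar_prod_def sum_distrib_left mult.assoc lessThan_atLeast0 intro!: sum.cong)

text \<open>Derivatives of trajectories are componentwise, so the form is differentiated as a double
  sum of coordinate products and the result reassembled in the shape of
  \<open>v_dot\<close>.\<close>

lemma quad_form_has_real_derivative:
  assumes A: "A \<in> carrier_mat n n" and x: "\<And>s. s \<in> S \<Longrightarrow> x s \<in> carrier_vec n" and F: "F \<in> carrier_vec n"
    and t: "t \<in> S" and dx: "has_vec_derivative_within n x F t S"
  shows "((\<lambda>s. quad_form A (x s)) has_real_derivative x t \<bullet> (A *\<^sub>v F) + F \<bullet> (A *\<^sub>v x t)) (at t within S)"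
proof -
  have "((\<lambda>s. \<Sum>i<n. \<Sum>j<n. x s $ i * A $$ (i, j) * x s $ j) has_real_derivative
      (\<Sum>i<n. \<Sum>j<n. F $ i * A $$ (i, j) * x t $ j + F $ j * (x t $ i * A $$ (i, j)))) (at t within S)"
    using dx unfolding has_vec_derivative_within_def
    by (intro DERIV_sum DERIV_mult' DERIV_cmult_right) (auto intro!: derivative_eq_intros)
  moreover have "(\<Sum>i<n. \<Sum>j<n. F $ i * A $$ (i, j) * x t $ j + F $ j * (x t $ i * A $$ (i, j)))
      = x t \<bullet> (A *\<^sub>v F) + F \<bullet> (A *\<^sub>v x t)"
    using A x[OF t] F
    by (simp add: scalar_prod_def sum_distrib_left sum.distrib mult_ac lessThan_atLeast0)
  ultimately show ?thesis
    using x t quad_form_eq_sum[OF A]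
    by (auto elim!: has_field_derivative_transform_within[where d = 1])
qed

text \<open>The division with the single member \<open>{s..t}\<close> is enough.\<close>

lemma abs_continuous_imp_uniform:
  assumes "abs_continuous_on_interval a b x" "e > 0"
  obtains d where "d > 0" "\<And>s t. a \<le> s \<Longrightarrow> s \<le> t \<Longrightarrow> t \<le> b \<Longrightarrow> t - s < d \<Longrightarrow> norm_vec (x t - x s) < e"
proof -
  obtain d where "d > 0" and d: "\<And>D S. D division_of S \<Longrightarrow> S \<subseteq> {a..b} \<Longrightarrow> (\<Sum>k\<in>D. Sup k - Inf k) < d \<Longrightarrow>
      (\<Sum>k\<in>D. norm_vec (x (Sup k) - x (Inf k))) < e"
    using assms unfolding abs_continuous_on_interval_def by metis
  have "norm_vec (x t - x s) < e" if "a \<le> s" "s \<le> t" "t \<le> b" "t - s < d" for s t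
    using d[of "{{s..t}}" "{s..t}"] division_of_self[of s t] that by auto
  with \<open>d > 0\<close> that show ?thesis by blast
qed

lemma abs_continuous_imp_continuous_index:
  assumes ac: "abs_continuous_on_interval a b x" and x: "\<And>t. a \<le> t \<Longrightarrow> t \<le> b \<Longrightarrow> x t \<in> carrier_vec n" and k: "k < n"
  shows "continuous_on {a..b} (\<lambda>t. x t $ k)"
  unfolding continuous_on_iff
proof (intro ballI allI impI)
  fix t e :: real assume t: "t \<in> {a..b}" and "e > 0"
  obtain d where "d > 0" and d: "\<And>s t. a \<le> s \<Longrightarrow> s \<le> t \<Longrightarrow> t \<le> b \<Longrightarrow> t - s < d \<Longrightarrow> norm_vec (x t - x s) < e"
    using abs_continuous_imp_uniform[OF ac \<open>e > 0\<close>] by blast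
  have idx: "\<bar>x v $ k - x u $ k\<bar> < e" if "a \<le> u" "u \<le> v" "v \<le> b" "v - u < d" for u v
  proof -
    have xs: "x u \<in> carrier_vec n" "x v \<in> carrier_vec n" using x that by auto
    then have "x v $ k - x u $ k = (x v - x u) $ k" using k by simp
    then show ?thesis using abs_index_le_norm_vec[of "x v - x u" n k] xs k d[OF that] by simp
  qed
  have "dist (x s $ k) (x t $ k) < e" if "s \<in> {a..b}" "dist s t < d" for s
    using idx[of s t] idx[of t s] that t by (cases "s \<le> t") (auto simp: dist_real_def abs_minus_commute)
  then show "\<exists>d>0. \<forall>s\<in>{a..b}. dist s t < d \<longrightarrow> dist (x s $ k) (x t $ k) < e" using \<open>d > 0\<close> by blast
qed

lemma continuous_on_quad_form:
  assumes ac: "abs_continuous_on_interval a b x" and x: "\<And>t. a \<le> t \<Longrightarrow> t \<le> b \<Longrightarrow> x t \<in> carrier_vec n"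
    and A: "A \<in> carrier_mat n n"
  shows "continuous_on {a..b} (\<lambda>t. quad_form A (x t))"
proof -
  have "continuous_on {a..b} (\<lambda>t. \<Sum>i<n. \<Sum>j<n. x t $ i * A $$ (i, j) * x t $ j)"
    by (intro continuous_intros abs_continuous_imp_continuous_index[OF ac x]) auto
  then show ?thesis using x quad_form_eq_sum[OF A] by (auto elim!: continuous_on_eq)
qed

text \<open>The norm is the root of the form of the identity matrix, hence continuous in time, and
  the interval is compact.\<close>

lemma norm_vec_bounded_on_interval:
  assumes ac: "abs_continuous_on_interval a b x" and x: "\<And>t. a \<le> t \<Longrightarrow> t \<le> b \<Longrightarrow> x t \<in> carrier_vec n"
  obtains M where "M > 0" "\<And>t. a \<le> t \<Longrightarrow> t \<le> b \<Longrightarrow> norm_vec (x t) \<le> M"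
proof -
  have "norm_vec (x t) = sqrt (quad_form (1\<^sub>m n) (x t))" if "a \<le> t" "t \<le> b" for t
    using x[OF that] by (simp add: norm_vec_def quad_form_def)
  moreover have "continuous_on {a..b} (\<lambda>t. sqrt (quad_form (1\<^sub>m n) (x t)))"
    by (intro continuous_intros continuous_on_quad_form[OF ac x]) auto
  ultimately have "continuous_on {a..b} (\<lambda>t. norm_vec (x t))" by (auto elim!: continuous_on_eq)
  then have "bounded ((\<lambda>t. norm_vec (x t)) ` {a..b})"
    by (intro compact_imp_bounded compact_continuous_image) auto
  then obtain M where "\<And>t. a \<le> t \<Longrightarrow> t \<le> b \<Longrightarrow> norm_vec (x t) \<le> M" "M > 0"
    unfolding bounded_pos by force
  with that show ?thesis by blast
qed

text \<open>Monotone convergence for the truncations of q to \<open>{0..real k}\<close>.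
  Integrability is part of the conclusion, since \<open>integral\<close> is 0 by convention for a
  function that is not integrable and a bound on it would then be empty.\<close>

lemma nonneg_integrable_on_atLeast:
  fixes q :: "real \<Rightarrow> real"
  assumes int: "\<And>b. 0 \<le> b \<Longrightarrow> q integrable_on {0..b}" and bound: "\<And>b. 0 \<le> b \<Longrightarrow> integral {0..b} q \<le> M"
    and nonneg: "\<And>t. 0 \<le> t \<Longrightarrow> q t \<ge> 0"
  shows "q integrable_on {0..}" "integral {0..} q \<le> M"
proof -
  define f where "f k t = (if t \<in> {0..real k} then q t else 0)" for k :: nat and t
  have sub: "{0..real k} \<subseteq> {0..}" for k by auto
  have fi: "(f k has_integral integral {0..real k} q) {0..}" for k
    unfolding f_def using has_integral_restrict[OF sub[of k], of q] integrable_integral[OF int[of "real k"]] by simp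
  then have fint: "f k integrable_on {0..}" and fval: "integral {0..} (f k) = integral {0..real k} q" for k
    by (auto simp: integral_unique intro: has_integral_integrable)
  have lim: "(\<lambda>k. f k t) \<longlonglongrightarrow> q t" if "t \<in> {0..}" for t
  proof (rule tendsto_eventually)
    obtain k0 where "t \<le> real k0" using real_arch_simple by blast
    then have "f k t = q t" if "k \<ge> k0" for k using that \<open>t \<in> {0..}\<close> by (auto simp: f_def)
    then show "\<forall>\<^sub>F k in sequentially. f k t = q t" unfolding eventually_sequentially by blast
  qed
  have mono: "f k t \<le> f (Suc k) t" if "t \<in> {0..}" for k t
    using nonneg[of t] that by (auto simp: f_def)
  have "\<bar>integral {0..} (f k)\<bar> \<le> M" for k
    unfolding fval using bound[of "real k"] integral_nonneg[OF int[of "real k"]] nonneg by simp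
  then have "bounded (range (\<lambda>k. integral {0..} (f k)))" unfolding bounded_iff by auto
  from monotone_convergence_increasing[OF fint mono lim this]
  have *: "q integrable_on {0..}" "(\<lambda>k. integral {0..} (f k)) \<longlonglongrightarrow> integral {0..} q" by auto
  show "q integrable_on {0..}" by fact
  show "integral {0..} q \<le> M"
    by (rule LIMSEQ_le_const2[OF *(2)]) (use bound fval in auto)
qed

section \<open>The Lyapunov function under the Lyapunov-Metzler inequality\<close>

locale Lyapunov_Metzler =
  fixes n N :: nat and A B K P :: "nat \<Rightarrow> real mat" and Q :: "real mat" and \<pi> :: "nat \<Rightarrow> nat \<Rightarrow> real"
  assumes N: "N \<ge> 1"
    and P: "\<And>i. i \<in> {1..N} \<Longrightarrow> pos_def_mat n (P i)"
    and Q: "pos_def_mat n Q"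
    and \<pi>: "\<pi> \<in> M_plus N"
    and closed_loop: "\<And>i. i \<in> {1..N} \<Longrightarrow> A i + B i * K i \<in> carrier_mat n n"
    and decrease: "\<And>i x. i \<in> {1..N} \<Longrightarrow> x \<in> carrier_vec n \<Longrightarrow>
      2 * (mode_field A B K i x \<bullet> (P i *\<^sub>v x)) \<le> - quad_form Q x - (\<Sum>j\<in>{1..N}. \<pi> j i * quad_form (P j) x)"
begin

abbreviation \<sigma> :: "real vec \<Rightarrow> nat" where "\<sigma> \<equiv> switching_law N P"

text \<open>Defined through the selected mode, so that agreement with a smooth form at a given point
  holds by definition; that it is the minimum is \<open>V_eq_Min\<close>.\<close>

definition V :: "real vec \<Rightarrow> real" where "V x = quad_form (P (\<sigma> x)) x"

lemma P_carrier: "i \<in> {1..N} \<Longrightarrow> P i \<in> carrier_mat n n"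
  using P by (simp add: pos_def_mat_def)

lemma Q_carrier: "Q \<in> carrier_mat n n"
  using Q by (simp add: pos_def_mat_def)

lemma sigma_range: "\<sigma> x \<in> {1..N}"
  by (rule switching_law_minimizes[OF N])

lemma V_le: "j \<in> {1..N} \<Longrightarrow> V x \<le> quad_form (P j) x"
  unfolding V_def by (rule switching_law_minimizes[OF N])

lemma V_eq_Min: "V x = Min ((\<lambda>i. quad_form (P i) x) ` {1..N})"
proof (rule Min_eqI[symmetric])
  show "V x \<in> (\<lambda>i. quad_form (P i) x) ` {1..N}" unfolding V_def using sigma_range by blast
qed (use V_le in auto)

lemma quad_form_Q_nonneg: "x \<in> carrier_vec n \<Longrightarrow> quad_form Q x \<ge> 0"
  using pos_def_mat_coercive[OF Q] by (metis mult_nonneg_nonneg less_imp_le order_trans zero_le_power2)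

lemma V_lower_bound:
  obtains c where "c > 0" "\<And>x. x \<in> carrier_vec n \<Longrightarrow> c * (norm_vec x)\<^sup>2 \<le> V x"
proof -
  have "\<exists>c>0. \<forall>x\<in>carrier_vec n. c * (norm_vec x)\<^sup>2 \<le> quad_form (P i) x" if "i \<in> {1..N}" for i
    using pos_def_mat_coercive[OF P[OF that]] by metis
  then obtain c where c: "\<And>i. i \<in> {1..N} \<Longrightarrow> c i > 0"
    "\<And>i x. i \<in> {1..N} \<Longrightarrow> x \<in> carrier_vec n \<Longrightarrow> c i * (norm_vec x)\<^sup>2 \<le> quad_form (P i) x"
    by metis
  define c0 where "c0 = Min (c ` {1..N})"
  have "c0 > 0" unfolding c0_def using c(1) N by (subst Min_gr_iff) auto
  moreover have "c0 * (norm_vec x)\<^sup>2 \<le> V x" if x: "x \<in> carrier_vec n" for x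
  proof -
    have "c0 \<le> c (\<sigma> x)" unfolding c0_def using sigma_range by (intro Min_le) auto
    then have "c0 * (norm_vec x)\<^sup>2 \<le> c (\<sigma> x) * (norm_vec x)\<^sup>2" by (intro mult_right_mono) auto
    also have "\<dots> \<le> V x" unfolding V_def by (rule c(2)[OF sigma_range x])
    finally show ?thesis .
  qed
  ultimately show ?thesis using that by blast
qed

text \<open>V lies below every form, so a bound for the single form of mode 1 is enough.\<close>

lemma V_upper_bound:
  obtains C where "C > 0" "\<And>x. x \<in> carrier_vec n \<Longrightarrow> V x \<le> C * (norm_vec x)\<^sup>2"
proof -
  have 1: "1 \<in> {1..N}" using N by simp
  obtain C where C: "C > 0" "\<And>x y. x \<in> carrier_vec n \<Longrightarrow> y \<in> carrier_vec n \<Longrightarrow>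
      \<bar>x \<bullet> (P 1 *\<^sub>v y)\<bar> \<le> C * norm_vec x * norm_vec y"
    using bilinear_form_bound[OF P_carrier[OF 1]] by blast
  have "V x \<le> C * (norm_vec x)\<^sup>2" if "x \<in> carrier_vec n" for x
    using V_le[OF 1, of x] C(2)[OF that that] by (simp add: quad_form_def power2_eq_square mult.assoc)
  with C(1) that show ?thesis by blast
qed

text \<open>V y is at most the form selected at x, evaluated at y, and conversely, so each one-sided
  difference is controlled by a single form. The largest of the N constants serves for both.\<close>

lemma V_diff_bound:
  obtains C where "C > 0" "\<And>x y. x \<in> carrier_vec n \<Longrightarrow> y \<in> carrier_vec n \<Longrightarrow>
    \<bar>V y - V x\<bar> \<le> C * norm_vec (y - x) * (norm_vec x + norm_vec y)"
proof -
  have "\<exists>C>0. \<forall>x\<in>carrier_vec n. \<forall>y\<in>carrier_vec n.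
      \<bar>quad_form (P i) y - quad_form (P i) x\<bar> \<le> C * norm_vec (y - x) * (norm_vec x + norm_vec y)"
    if "i \<in> {1..N}" for i
    using quad_form_diff_bound[OF P_carrier[OF that]] by metis
  then obtain c where c: "\<And>i. i \<in> {1..N} \<Longrightarrow> c i > 0"
    "\<And>i x y. i \<in> {1..N} \<Longrightarrow> x \<in> carrier_vec n \<Longrightarrow> y \<in> carrier_vec n \<Longrightarrow>
      \<bar>quad_form (P i) y - quad_form (P i) x\<bar> \<le> c i * norm_vec (y - x) * (norm_vec x + norm_vec y)"
    by metis
  define C where "C = Max (c ` {1..N})"
  have cC: "c i \<le> C" if "i \<in> {1..N}" for i unfolding C_def using that by (intro Max_ge) auto
  then have "C > 0" using c(1)[OF sigma_range] sigma_range by (meson less_le_trans)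
  have diff: "\<bar>quad_form (P i) y - quad_form (P i) x\<bar> \<le> C * norm_vec (y - x) * (norm_vec x + norm_vec y)"
    if "i \<in> {1..N}" "x \<in> carrier_vec n" "y \<in> carrier_vec n" for i x y
    by (rule order_trans[OF c(2)[OF that]]) (use cC[OF that(1)] in \<open>auto intro!: mult_right_mono\<close>)
  have "\<bar>V y - V x\<bar> \<le> C * norm_vec (y - x) * (norm_vec x + norm_vec y)"
    if x: "x \<in> carrier_vec n" and y: "y \<in> carrier_vec n" for x y
    using diff[OF sigma_range x y, of x] diff[OF sigma_range x y, of y]
      V_le[OF sigma_range, of x y] V_le[OF sigma_range, of y x]
    unfolding V_def by linarith
  with \<open>C > 0\<close> that show ?thesis by blast
qed

lemma active_modes_subset: "active_modes n N \<sigma> x \<subseteq> {1..N}"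
  by (auto simp: active_modes_def)

lemma mode_field_carrier: "i \<in> {1..N} \<Longrightarrow> x \<in> carrier_vec n \<Longrightarrow> mode_field A B K i x \<in> carrier_vec n"
  unfolding mode_field_def using closed_loop by (metis mult_mat_vec_carrier)

text \<open>
  In an active mode \<open>i\<close> the value \<open>x\<^sup>T P\<^sub>i x\<close> is minimal; as column \<open>i\<close> of \<open>\<pi>\<close> sums to zero and is nonnegative off
  the diagonal, the Metzler term is then nonnegative.
\<close>

lemma active_mode_decrease:
  assumes x: "x \<in> carrier_vec n" and i: "i \<in> active_modes n N \<sigma> x" and w: "w \<ge> 0"
  shows "v_dot P i x (w \<cdot>\<^sub>v mode_field A B K i x) \<le> - (w * quad_form Q x)"
proof -
  have iN: "i \<in> {1..N}" using i active_modes_subset by blast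
  define f where "f = mode_field A B K i x"
  have f: "f \<in> carrier_vec n" unfolding f_def by (rule mode_field_carrier[OF iN x])
  have Pi: "P i \<in> carrier_mat n n" "(P i)\<^sup>T = P i" using P[OF iN] by (auto simp: pos_def_mat_def)
  have "x \<bullet> (P i *\<^sub>v f) = f \<bullet> (P i *\<^sub>v x)"
    using transpose_vec_mult_scalar[OF Pi(1) f x] Pi x f by (simp add: comm_scalar_prod[of _ n])
  then have v: "v_dot P i x (w \<cdot>\<^sub>v f) = w * (2 * (f \<bullet> (P i *\<^sub>v x)))"
    unfolding v_dot_def using Pi x f by (simp add: mult_mat_vec)
  have "(\<Sum>j\<in>{1..N}. \<pi> j i * quad_form (P i) x) \<le> (\<Sum>j\<in>{1..N}. \<pi> j i * quad_form (P j) x)"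
  proof (rule sum_mono)
    fix j assume j: "j \<in> {1..N}"
    show "\<pi> j i * quad_form (P i) x \<le> \<pi> j i * quad_form (P j) x"
    proof (cases "j = i")
      case False
      then have "\<pi> j i > 0" using \<pi> j iN by (simp add: M_plus_def)
      then show ?thesis using active_mode_minimizes[OF N P_carrier x i j] by simp
    qed simp
  qed
  moreover have "(\<Sum>j\<in>{1..N}. \<pi> j i * quad_form (P i) x) = 0"
    using \<pi> iN by (simp add: M_plus_def flip: sum_distrib_right)
  ultimately have "2 * (f \<bullet> (P i *\<^sub>v x)) \<le> - quad_form Q x"
    using decrease[OF iN x] unfolding f_def by linarith
  then show ?thesis unfolding f_def[symmetric] v using mult_left_mono[OF _ w] by fastforce
qed

section \<open>Dissipation and convergence along one solution\<close>

definition solutions :: "(real \<Rightarrow> real vec) set" where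
  "solutions = closed_loop_solutions n N A B P K \<sigma>"

context
  fixes x :: "real \<Rightarrow> real vec"
  assumes sol: "x \<in> solutions"
begin

lemma x_carrier: "0 \<le> t \<Longrightarrow> x t \<in> carrier_vec n"
  using sol by (simp add: solutions_def closed_loop_solutions_def)

lemma x_abs_continuous: "0 \<le> b \<Longrightarrow> abs_continuous_on_interval 0 b x"
  using sol by (simp add: solutions_def closed_loop_solutions_def)

lemma continuous_on_cost: "0 \<le> b \<Longrightarrow> continuous_on {0..b} (\<lambda>t. quad_form Q (x t))"
  by (rule continuous_on_quad_form[OF x_abs_continuous x_carrier Q_carrier])

lemma cost_integrable: "0 \<le> a \<Longrightarrow> (\<lambda>t. quad_form Q (x t)) integrable_on {a..b}"
proof (cases "a \<le> b")
  case True
  assume "0 \<le> a"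
  then have "continuous_on {a..b} (\<lambda>t. quad_form Q (x t))"
    using continuous_on_subset[OF continuous_on_cost[of b], of "{a..b}"] True by auto
  then show ?thesis by (rule integrable_continuous_real)
qed (simp add: integrable_on_empty)

text \<open>Each active field decreases its own form by at least its weight times the cost. The
  weights sum to one, so the inequality of the solution concept yields the full cost for the
  selected form.\<close>

lemma ae_decrease:
  obtains E where "negligible E"
    "\<And>t. 0 \<le> t \<Longrightarrow> t \<notin> E \<Longrightarrow> \<exists>F\<in>carrier_vec n. has_vec_derivative_within n x F t {0..} \<and>
       v_dot P (\<sigma> (x t)) (x t) F \<le> - quad_form Q (x t)"
proof -
  let ?good = "\<lambda>t. \<exists>w :: nat \<Rightarrow> real.
          let M = active_modes n N \<sigma> (x t);
              \<xi> = (\<lambda>i. w i \<cdot>\<^sub>v mode_field A B K i (x t));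
              F = finsum_vec TYPE(real) n \<xi> M
          in (\<forall>i\<in>M. w i \<ge> 0) \<and> (\<Sum>i\<in>M. w i) = 1 \<and>
             has_vec_derivative_within n x F t {0..} \<and>
             v_dot P (\<sigma> (x t)) (x t) F \<le> (\<Sum>i\<in>M. v_dot P i (x t) (\<xi> i))"
  have "AE t in lebesgue. t \<ge> 0 \<longrightarrow> ?good t"
    using sol by (simp add: solutions_def closed_loop_solutions_def)
  then obtain E where E: "E \<in> null_sets lebesgue" "{t \<in> space lebesgue. \<not> (t \<ge> 0 \<longrightarrow> ?good t)} \<subseteq> E"
    unfolding eventually_ae_filter by blast
  have "\<exists>F\<in>carrier_vec n. has_vec_derivative_within n x F t {0..} \<and>
       v_dot P (\<sigma> (x t)) (x t) F \<le> - quad_form Q (x t)" if t: "0 \<le> t" "t \<notin> E" for t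
  proof -
    let ?M = "active_modes n N \<sigma> (x t)"
    have "?good t" using E(2) t by auto
    then obtain w :: "nat \<Rightarrow> real" where w: "\<forall>i\<in>?M. w i \<ge> 0" "(\<Sum>i\<in>?M. w i) = 1"
      and d: "has_vec_derivative_within n x (finsum_vec TYPE(real) n (\<lambda>i. w i \<cdot>\<^sub>v mode_field A B K i (x t)) ?M) t {0..}"
      and v: "v_dot P (\<sigma> (x t)) (x t) (finsum_vec TYPE(real) n (\<lambda>i. w i \<cdot>\<^sub>v mode_field A B K i (x t)) ?M)
        \<le> (\<Sum>i\<in>?M. v_dot P i (x t) (w i \<cdot>\<^sub>v mode_field A B K i (x t)))"
      unfolding Let_def by blast
    have F: "finsum_vec TYPE(real) n (\<lambda>i. w i \<cdot>\<^sub>v mode_field A B K i (x t)) ?M \<in> carrier_vec n"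
      using mode_field_carrier[OF _ x_carrier[OF t(1)]] active_modes_subset[of "x t"]
      by (intro finsum_vec_closed) auto
    have "(\<Sum>i\<in>?M. v_dot P i (x t) (w i \<cdot>\<^sub>v mode_field A B K i (x t))) \<le> (\<Sum>i\<in>?M. - (w i * quad_form Q (x t)))"
      using w(1) active_mode_decrease[OF x_carrier[OF t(1)]] by (intro sum_mono) auto
    also have "\<dots> = - quad_form Q (x t)" using w(2) by (simp add: sum_negf flip: sum_distrib_right)
    finally show ?thesis using v d F by (intro bexI[OF _ F]) auto
  qed
  with E(1) that show ?thesis by (auto simp: negligible_iff_null_sets)
qed

text \<open>Adding the accumulated cost to V turns dissipation into monotonicity of the single
  function g. Both integrals start at 0 so that g depends on one time only.\<close>

lemma dissipation:
  assumes "0 \<le> a" "a \<le> b"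
  shows "V (x b) + integral {0..b} (\<lambda>t. quad_form Q (x t)) \<le> V (x a) + integral {0..a} (\<lambda>t. quad_form Q (x t))"
proof -
  define q where "q t = quad_form Q (x t)" for t
  define g where "g t = V (x t) + integral {0..t} q" for t
  have b: "0 \<le> b" using assms by simp
  have qi: "q integrable_on {s..t}" if "0 \<le> s" for s t unfolding q_def using cost_integrable that by blast
  have qc: "continuous_on {0..t} q" if "0 \<le> t" for t unfolding q_def using continuous_on_cost that by blast
  obtain C where "C > 0" and C: "\<And>x y. x \<in> carrier_vec n \<Longrightarrow> y \<in> carrier_vec n \<Longrightarrow>
      \<bar>V y - V x\<bar> \<le> C * norm_vec (y - x) * (norm_vec x + norm_vec y)"
    using V_diff_bound by blast
  obtain M where "M > 0" and M: "\<And>t. 0 \<le> t \<Longrightarrow> t \<le> b \<Longrightarrow> norm_vec (x t) \<le> M"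
    using norm_vec_bounded_on_interval[OF x_abs_continuous[OF b] x_carrier] by blast
  have "bounded (q ` {0..b})" by (intro compact_imp_bounded compact_continuous_image qc[OF b]) simp
  then obtain H where "H > 0" and H: "\<And>t. 0 \<le> t \<Longrightarrow> t \<le> b \<Longrightarrow> \<bar>q t\<bar> \<le> H"
    unfolding bounded_pos by force
  \<comment> \<open>C and M come from the Lipschitz estimate of V on the ball of radius M, H from
    the bound on the cost. Increments of g are thus controlled by those of x and of time.\<close>
  have g_diff: "\<bar>g v - g u\<bar> \<le> 2 * C * M * norm_vec (x v - x u) + H * (v - u)"
    if uv: "0 \<le> u" "u \<le> v" "v \<le> b" for u v
  proof -
    have "\<bar>V (x v) - V (x u)\<bar> \<le> C * norm_vec (x v - x u) * (norm_vec (x u) + norm_vec (x v))"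
      using C[of "x u" "x v"] x_carrier uv by simp
    also have "\<dots> \<le> C * norm_vec (x v - x u) * (2 * M)"
      using M[of u] M[of v] uv \<open>C > 0\<close> by (intro mult_left_mono) auto
    finally have 1: "\<bar>V (x v) - V (x u)\<bar> \<le> 2 * C * M * norm_vec (x v - x u)" by (simp add: mult_ac)
    have "integral {0..v} q = integral {0..u} q + integral {u..v} q"
      using Henstock_Kurzweil_Integration.integral_combine[OF uv(1,2) qi] by simp
    moreover have "\<bar>integral {u..v} q\<bar> \<le> H * (v - u)"
    proof -
      have "continuous_on {u..v} q" using continuous_on_subset[OF qc[of v]] uv by auto
      from integral_bound[OF uv(2) this, of H] show ?thesis using H uv by auto
    qed
    ultimately show ?thesis using 1 unfolding g_def by linarith
  qed
  obtain E where E: "negligible E" and good: "\<And>t. 0 \<le> t \<Longrightarrow> t \<notin> E \<Longrightarrow>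
      \<exists>F\<in>carrier_vec n. has_vec_derivative_within n x F t {0..} \<and> v_dot P (\<sigma> (x t)) (x t) F \<le> - quad_form Q (x t)"
    using ae_decrease by blast
  have "g b \<le> g a"
  proof (rule abs_continuous_right_Dini_nonincreasing[OF assms(2) _ E])
    fix e :: real assume "e > 0"
    \<comment> \<open>The two thresholds are chosen so that trajectory and time contribute at most e
      / 2 each.\<close>
    then have "e / (4 * C * M) > 0" using \<open>C > 0\<close> \<open>M > 0\<close> by simp
    then obtain \<delta> where "\<delta> > 0" and \<delta>: "\<And>d S. d division_of S \<Longrightarrow> S \<subseteq> {0..b} \<Longrightarrow> (\<Sum>k\<in>d. Sup k - Inf k) < \<delta> \<Longrightarrow>
        (\<Sum>k\<in>d. norm_vec (x (Sup k) - x (Inf k))) < e / (4 * C * M)"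
      using x_abs_continuous[OF b] unfolding abs_continuous_on_interval_def by metis
    define \<delta>' where "\<delta>' = min \<delta> (e / (2 * H))"
    have "\<delta>' > 0" using \<open>\<delta> > 0\<close> \<open>e > 0\<close> \<open>H > 0\<close> by (simp add: \<delta>'_def)
    moreover have "(\<Sum>k\<in>d. \<bar>g (Sup k) - g (Inf k)\<bar>) < e"
      if d: "d division_of S" "S \<subseteq> {a..b}" "(\<Sum>k\<in>d. Sup k - Inf k) < \<delta>'" for d S
    proof -
      have "\<bar>g (Sup k) - g (Inf k)\<bar> \<le> 2 * C * M * norm_vec (x (Sup k) - x (Inf k)) + H * (Sup k - Inf k)"
        if k: "k \<in> d" for k
      proof -
        obtain u v where uv: "k = {u..v}" using division_ofD(4)[OF d(1) k] by auto
        have "k \<noteq> {}" "k \<subseteq> {a..b}" using division_ofD(2,3)[OF d(1) k] d(2) by auto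
        then show ?thesis using g_diff[of u v] uv assms by auto
      qed
      then have "(\<Sum>k\<in>d. \<bar>g (Sup k) - g (Inf k)\<bar>) \<le>
          (\<Sum>k\<in>d. 2 * C * M * norm_vec (x (Sup k) - x (Inf k)) + H * (Sup k - Inf k))"
        by (rule sum_mono)
      also have "\<dots> = 2 * C * M * (\<Sum>k\<in>d. norm_vec (x (Sup k) - x (Inf k))) + H * (\<Sum>k\<in>d. Sup k - Inf k)"
        by (simp add: sum.distrib sum_distrib_left)
      also have "\<dots> < e / 2 + e / 2"
      proof (rule add_strict_mono)
        have "S \<subseteq> {0..b}" using d(2) assms by auto
        then have "(\<Sum>k\<in>d. norm_vec (x (Sup k) - x (Inf k))) < e / (4 * C * M)"
          using \<delta>[OF d(1)] d(3) by (simp add: \<delta>'_def)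
        then show "2 * C * M * (\<Sum>k\<in>d. norm_vec (x (Sup k) - x (Inf k))) < e / 2"
          using \<open>C > 0\<close> \<open>M > 0\<close> by (simp add: field_simps)
        have "(\<Sum>k\<in>d. Sup k - Inf k) < e / (2 * H)" using d(3) by (simp add: \<delta>'_def)
        then show "H * (\<Sum>k\<in>d. Sup k - Inf k) < e / 2" using \<open>H > 0\<close> by (simp add: field_simps)
      qed
      finally show ?thesis by simp
    qed
    ultimately show "\<exists>\<delta>>0. \<forall>d S. d division_of S \<and> S \<subseteq> {a..b} \<and> (\<Sum>k\<in>d. Sup k - Inf k) < \<delta> \<longrightarrow>
        (\<Sum>k\<in>d. \<bar>g (Sup k) - g (Inf k)\<bar>) < e" by blast
  next
    fix t e :: real assume t: "a \<le> t" "t < b" "t \<notin> E" and e: "e > 0"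
    have t0: "0 \<le> t" using t assms by simp
    obtain F where F: "F \<in> carrier_vec n" "has_vec_derivative_within n x F t {0..}"
      "v_dot P (\<sigma> (x t)) (x t) F \<le> - q t"
      using good[OF t0 t(3)] unfolding q_def by blast
    \<comment> \<open>The mode selected at t is frozen: \<phi> is differentiable at t, lies above g
      and equals it at t.\<close>
    define \<phi> where "\<phi> s = quad_form (P (\<sigma> (x t))) (x s) + integral {0..s} q" for s
    have "((\<lambda>s. quad_form (P (\<sigma> (x t))) (x s)) has_real_derivative v_dot P (\<sigma> (x t)) (x t) F) (at t within {0..})"
      unfolding v_dot_def
      by (rule quad_form_has_real_derivative[OF P_carrier[OF sigma_range] _ F(1) _ F(2)]) (use x_carrier t0 in auto)
    \<comment> \<open>The restriction matches the compact interval on which the integral is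
      differentiated; afterwards only times to the right of t are used.\<close>
    then have "((\<lambda>s. quad_form (P (\<sigma> (x t))) (x s)) has_real_derivative v_dot P (\<sigma> (x t)) (x t) F) (at t within {0..t + 1})"
      by (rule DERIV_subset) auto
    moreover have "((\<lambda>s. integral {0..s} q) has_real_derivative q t) (at t within {0..t + 1})"
      using qc[of "t + 1"] t0 by (intro integral_has_real_derivative) auto
    ultimately have "(\<phi> has_real_derivative v_dot P (\<sigma> (x t)) (x t) F + q t) (at t within {0..t + 1})"
      unfolding \<phi>_def by (rule DERIV_add)
    then have "((\<lambda>s. (\<phi> s - \<phi> t) / (s - t)) \<longlongrightarrow> v_dot P (\<sigma> (x t)) (x t) F + q t) (at t within {0..t + 1})"
      by (simp add: has_field_derivative_iff)
    moreover have "v_dot P (\<sigma> (x t)) (x t) F + q t < e" using F(3) e by simp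
    ultimately have "\<forall>\<^sub>F s in at t within {0..t + 1}. (\<phi> s - \<phi> t) / (s - t) < e"
      by (rule order_tendstoD)
    then obtain d where "d > 0" and d: "\<And>s. s \<in> {0..t + 1} \<Longrightarrow> s \<noteq> t \<Longrightarrow> dist s t < d \<Longrightarrow> (\<phi> s - \<phi> t) / (s - t) < e"
      unfolding eventually_at by blast
    \<comment> \<open>In the step size, 1 keeps s inside \<open>{0..t + 1}\<close> and
      \<open>d / 2\<close> keeps it strictly within distance d.\<close>
    have "g s - g t \<le> e * (s - t)" if s: "t \<le> s" "s \<le> t + min 1 (d / 2)" for s
    proof (cases "s = t")
      case False
      then have "s > t" using s by simp
      then have "\<phi> s - \<phi> t \<le> e * (s - t)"
        using d[of s] s t0 \<open>d > 0\<close> by (simp add: dist_real_def pos_divide_less_eq min_def split: if_splits)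
      moreover have "g s \<le> \<phi> s" unfolding g_def \<phi>_def using V_le[OF sigma_range] by simp
      moreover have "g t = \<phi> t" by (simp add: g_def \<phi>_def V_def)
      ultimately show ?thesis by simp
    qed simp
    moreover have "min 1 (d / 2) > 0" using \<open>d > 0\<close> by simp
    ultimately show "\<exists>h>0. \<forall>s. t \<le> s \<and> s \<le> t + h \<longrightarrow> g s - g t \<le> e * (s - t)" by blast
  qed
  then show ?thesis unfolding g_def q_def .
qed

lemma V_nonincreasing:
  assumes "0 \<le> a" "a \<le> b"
  shows "V (x b) \<le> V (x a)"
proof -
  have "integral {0..b} (\<lambda>t. quad_form Q (x t)) = integral {0..a} (\<lambda>t. quad_form Q (x t)) + integral {a..b} (\<lambda>t. quad_form Q (x t))"
    using Henstock_Kurzweil_Integration.integral_combine[OF assms cost_integrable] by simp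
  moreover have "integral {a..b} (\<lambda>t. quad_form Q (x t)) \<ge> 0"
    using assms x_carrier quad_form_Q_nonneg by (intro integral_nonneg cost_integrable) auto
  ultimately show ?thesis using dissipation[OF assms] by linarith
qed

lemma V_nonneg: "0 \<le> t \<Longrightarrow> V (x t) \<ge> 0"
  using V_lower_bound x_carrier
  by (metis mult_nonneg_nonneg less_imp_le order_trans zero_le_power2)

lemma cost_bound: "0 \<le> b \<Longrightarrow> V (x b) + integral {0..b} (\<lambda>t. quad_form Q (x t)) \<le> V (x 0)"
  using dissipation[of 0 b] by simp

lemma cost_integral:
  "(\<lambda>t. quad_form Q (x t)) integrable_on {0..}"
  "integral {0..} (\<lambda>t. quad_form Q (x t)) \<le> V (x 0)"
proof -
  have "integral {0..b} (\<lambda>t. quad_form Q (x t)) \<le> V (x 0)" if "0 \<le> b" for b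
    using cost_bound[OF that] V_nonneg[OF that] by linarith
  note * = nonneg_integrable_on_atLeast[OF cost_integrable this quad_form_Q_nonneg[OF x_carrier]]
  show "(\<lambda>t. quad_form Q (x t)) integrable_on {0..}" by (rule *) auto
  show "integral {0..} (\<lambda>t. quad_form Q (x t)) \<le> V (x 0)" by (rule *) auto
qed

text \<open>Since \<open>V\<close> is nonincreasing and \<open>x\<^sup>T Q x \<ge> \<mu> V x\<close>, the cost bound gives \<open>\<mu> t V (x t) \<le> V (x 0)\<close>.\<close>

lemma norm_tendsto_zero: "((\<lambda>t. norm_vec (x t)) \<longlongrightarrow> 0) at_top"
proof -
  obtain c where "c > 0" and c: "\<And>x. x \<in> carrier_vec n \<Longrightarrow> c * (norm_vec x)\<^sup>2 \<le> V x" using V_lower_bound by blast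
  obtain C where "C > 0" and C: "\<And>x. x \<in> carrier_vec n \<Longrightarrow> V x \<le> C * (norm_vec x)\<^sup>2" using V_upper_bound by blast
  obtain \<kappa> where "\<kappa> > 0" and \<kappa>: "\<And>x. x \<in> carrier_vec n \<Longrightarrow> \<kappa> * (norm_vec x)\<^sup>2 \<le> quad_form Q x"
    using pos_def_mat_coercive[OF Q] by blast
  \<comment> \<open>The cost is at least \<kappa> times the squared norm and V at most C times
    it.\<close>
  define \<mu> where "\<mu> = \<kappa> / C"
  have "\<mu> > 0" using \<open>\<kappa> > 0\<close> \<open>C > 0\<close> by (simp add: \<mu>_def)
  have rate: "\<mu> * V y \<le> quad_form Q y" if y: "y \<in> carrier_vec n" for y
  proof -
    have "\<mu> * V y \<le> \<mu> * (C * (norm_vec y)\<^sup>2)" using C[OF y] \<open>\<mu> > 0\<close> by simp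
    also have "\<dots> = \<kappa> * (norm_vec y)\<^sup>2" using \<open>C > 0\<close> by (simp add: \<mu>_def)
    finally show ?thesis using \<kappa>[OF y] by simp
  qed
  \<comment> \<open>A decay of order 1 / sqrt t is weaker than exponential decay, but it needs only
    the cost bound and the monotonicity of V.\<close>
  have bound: "norm_vec (x t) \<le> sqrt (V (x 0) / (c * \<mu>) / t)" if t: "t > 0" for t
  proof -
    have "t * (\<mu> * V (x t)) = integral {0..t} (\<lambda>_. \<mu> * V (x t))" using t by simp
    also have "\<dots> \<le> integral {0..t} (\<lambda>t. quad_form Q (x t))"
    proof (rule integral_le)
      fix s assume s: "s \<in> {0..t}"
      have "\<mu> * V (x t) \<le> \<mu> * V (x s)" using V_nonincreasing[of s t] s \<open>\<mu> > 0\<close> by simp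
      also have "\<dots> \<le> quad_form Q (x s)" using rate x_carrier s by simp
      finally show "\<mu> * V (x t) \<le> quad_form Q (x s)" .
    qed (use cost_integrable in auto)
    also have "\<dots> \<le> V (x 0)" using cost_bound[of t] V_nonneg[of t] t by simp
    finally have "t * \<mu> * V (x t) \<le> V (x 0)" by (simp add: mult.assoc)
    moreover have "t * \<mu> * (c * (norm_vec (x t))\<^sup>2) \<le> t * \<mu> * V (x t)"
      using c[OF x_carrier] t \<open>\<mu> > 0\<close> by simp
    ultimately have "t * \<mu> * (c * (norm_vec (x t))\<^sup>2) \<le> V (x 0)" by (rule order_trans[rotated])
    then have "(norm_vec (x t))\<^sup>2 \<le> V (x 0) / (c * \<mu>) / t"
      using t \<open>\<mu> > 0\<close> \<open>c > 0\<close> by (simp add: field_simps)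
    then show ?thesis by (rule real_le_rsqrt)
  qed
  have "((\<lambda>t. sqrt (V (x 0) / (c * \<mu>) / t)) \<longlongrightarrow> sqrt 0) at_top"
    by (intro tendsto_real_sqrt tendsto_divide_0[OF tendsto_const] filterlim_at_top_imp_at_infinity filterlim_ident)
  then have lim: "((\<lambda>t. sqrt (V (x 0) / (c * \<mu>) / t)) \<longlongrightarrow> 0) at_top" by simp
  show ?thesis
  proof (rule tendsto_sandwich[OF _ _ tendsto_const lim])
    show "\<forall>\<^sub>F t in at_top. norm_vec (x t) \<le> sqrt (V (x 0) / (c * \<mu>) / t)"
      using eventually_gt_at_top[of 0] by eventually_elim (rule bound)
  qed simp
qed

end

theorem solutions_globally_asymptotically_stable: "globally_asymptotically_stable solutions"
  unfolding globally_asymptotically_stable_def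
proof (intro conjI allI impI ballI)
  fix \<epsilon> :: real assume "\<epsilon> > 0"
  obtain c where "c > 0" and c: "\<And>x. x \<in> carrier_vec n \<Longrightarrow> c * (norm_vec x)\<^sup>2 \<le> V x" using V_lower_bound by blast
  obtain C where "C > 0" and C: "\<And>x. x \<in> carrier_vec n \<Longrightarrow> V x \<le> C * (norm_vec x)\<^sup>2" using V_upper_bound by blast
  \<comment> \<open>Chosen so that C times \<delta> squared equals c times \<epsilon> squared, which
    closes the chain of bounds through V.\<close>
  define \<delta> where "\<delta> = \<epsilon> * sqrt (c / C)"
  have "\<delta> > 0" using \<open>\<epsilon> > 0\<close> \<open>c > 0\<close> \<open>C > 0\<close> by (simp add: \<delta>_def)
  moreover have "norm_vec (x t) < \<epsilon>" if x: "x \<in> solutions" "norm_vec (x 0) < \<delta>" and t: "t \<ge> 0" for x t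
  proof -
    have "c * (norm_vec (x t))\<^sup>2 \<le> V (x t)" by (rule c[OF x_carrier[OF x(1) t]])
    also have "\<dots> \<le> V (x 0)" by (rule V_nonincreasing[OF x(1)]) (use t in auto)
    also have "\<dots> \<le> C * (norm_vec (x 0))\<^sup>2" by (rule C[OF x_carrier[OF x(1)]]) simp
    also have "\<dots> < C * \<delta>\<^sup>2" using x(2) \<open>C > 0\<close> by (simp add: power_strict_mono)
    also have "\<dots> = c * \<epsilon>\<^sup>2" using \<open>c > 0\<close> \<open>C > 0\<close> by (simp add: \<delta>_def power_mult_distrib)
    finally have "(norm_vec (x t))\<^sup>2 < \<epsilon>\<^sup>2" using \<open>c > 0\<close> by simp
    then show ?thesis using \<open>\<epsilon> > 0\<close> by (rule power2_less_imp_less[OF _ less_imp_le])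
  qed
  ultimately show "\<exists>\<delta>>0. \<forall>x\<in>solutions. norm_vec (x 0) < \<delta> \<longrightarrow> (\<forall>t\<ge>0. norm_vec (x t) < \<epsilon>)" by blast
qed (rule norm_tendsto_zero)

end

section \<open>The closed loop of the data-driven design\<close>

theorem corollary1:
  fixes n m N :: nat
    and T :: "nat \<Rightarrow> nat"
    and A B X Xdot U \<Phi> \<Phi>11 \<Phi>12 \<Phi>22 P L :: "nat \<Rightarrow> real mat"
    and Q :: "real mat"
    and \<alpha> :: "nat \<Rightarrow> real"
    and \<pi> :: "nat \<Rightarrow> nat \<Rightarrow> real"
  assumes "N \<ge> 1"
    and "\<And>i. i \<in> {1..N} \<Longrightarrow> A i \<in> carrier_mat n n"
    and "\<And>i. i \<in> {1..N} \<Longrightarrow> B i \<in> carrier_mat n m"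
    and "\<And>i. i \<in> {1..N} \<Longrightarrow> X i \<in> carrier_mat n (T i)"
    and "\<And>i. i \<in> {1..N} \<Longrightarrow> Xdot i \<in> carrier_mat n (T i)"
    and "\<And>i. i \<in> {1..N} \<Longrightarrow> U i \<in> carrier_mat m (T i)"
    and "\<And>i. i \<in> {1..N} \<Longrightarrow> \<Phi>11 i \<in> carrier_mat n n"
    and "\<And>i. i \<in> {1..N} \<Longrightarrow> \<Phi>12 i \<in> carrier_mat n (T i)"
    and "\<And>i. i \<in> {1..N} \<Longrightarrow> \<Phi>22 i \<in> carrier_mat (T i) (T i)"
    and "\<And>i. i \<in> {1..N} \<Longrightarrow> \<Phi> i = block_mat [[\<Phi>11 i, \<Phi>12 i], [(\<Phi>12 i)\<^sup>T, \<Phi>22 i]]"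
    and "\<And>i. i \<in> {1..N} \<Longrightarrow> (\<Phi> i)\<^sup>T = \<Phi> i"
    and "\<And>i. i \<in> {1..N} \<Longrightarrow> neg_def_mat (T i) (\<Phi>22 i)"
    and "\<And>i. i \<in> {1..N} \<Longrightarrow>
           \<exists>W \<in> noise_set n (T i) (\<Phi> i). Xdot i = A i * X i + B i * U i + W"
    and "\<And>i. i \<in> {1..N} \<Longrightarrow> pos_def_mat n (P i)"
    and "\<And>i. i \<in> {1..N} \<Longrightarrow> \<alpha> i \<ge> 0"
    and "\<And>i. i \<in> {1..N} \<Longrightarrow> L i \<in> carrier_mat m n"
    and "pos_def_mat n Q"
    and "\<pi> \<in> M_plus N"
    and "\<And>i. i \<in> {1..N} \<Longrightarrow>
           (let \<Gamma> = Gamma_mat n m N (T i) (X i) (Xdot i) (U i)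
            in pos_semidef_mat (n + (N - 1) * n + n + n + m)
                 (design_mat n m N P \<pi> Q (L i) i - \<alpha> i \<cdot>\<^sub>m (\<Gamma> * \<Phi> i * \<Gamma>\<^sup>T)))"
  shows "let K = (\<lambda>i. L i * P i);
             S = closed_loop_solutions n N A B P K (switching_law N P)
         in globally_asymptotically_stable S \<and>
            (\<forall>x\<in>S. (\<lambda>t. quad_form Q (x t)) integrable_on {0..} \<and>
                   integral {0..} (\<lambda>t. quad_form Q (x t))
                     \<le> Min ((\<lambda>i. quad_form (P i) (x 0)) ` {1..N}))"
proof -
  define K where "K = (\<lambda>i. L i * P i)"
  \<comment> \<open>Data and noise enter only in discharging these assumptions; what follows
    concerns the true closed loop alone.\<close>
  interpret Lyapunov_Metzler n N A B K P Q \<pi>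
  proof
    show "N \<ge> 1" "pos_def_mat n Q" "\<pi> \<in> M_plus N" by fact+
  next
    fix i assume i: "i \<in> {1..N}"
    show Pi: "pos_def_mat n (P i)" using assms(14)[OF i] .
    have "B i * (L i * P i) \<in> carrier_mat n n"
      using assms(3)[OF i] assms(16)[OF i] Pi by (metis mult_carrier_mat pos_def_mat_def)
    then show "A i + B i * K i \<in> carrier_mat n n" using assms(2)[OF i] by (simp add: K_def)
    \<comment> \<open>\<open>\<Phi> i\<close> is given through its blocks, so its size is recovered
      from theirs.\<close>
    have "hcat [\<Phi>11 i, \<Phi>12 i] \<in> carrier_mat n (n + T i)" "hcat [(\<Phi>12 i)\<^sup>T, \<Phi>22 i] \<in> carrier_mat (T i) (n + T i)"
      using assms(7-9)[OF i] by (auto intro!: hcat_carrier simp del: hcat.simps(3))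
    then have \<Phi>: "\<Phi> i \<in> carrier_mat (n + T i) (n + T i)"
      unfolding assms(10)[OF i] block_mat_def by (simp del: hcat.simps(3))
    obtain W where W: "W \<in> noise_set n (T i) (\<Phi> i)" "Xdot i = A i * X i + B i * U i + W"
      using assms(13)[OF i] by blast
    fix x :: "real vec" assume x: "x \<in> carrier_vec n"
    show "2 * (mode_field A B K i x \<bullet> (P i *\<^sub>v x)) \<le> - quad_form Q x - (\<Sum>j\<in>{1..N}. \<pi> j i * quad_form (P j) x)"
      unfolding mode_field_def K_def
      by (rule design_mat_imp_Lyapunov_Metzler[OF i assms(2-6)[OF i] \<Phi> W assms(14) assms(15,16)[OF i]
            assms(17,18) assms(19)[OF i, unfolded Let_def] x])
  qed
  have S: "closed_loop_solutions n N A B P K \<sigma> = solutions" by (simp add: solutions_def)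
  show ?thesis
    unfolding Let_def K_def[symmetric] S V_eq_Min[symmetric]
    using solutions_globally_asymptotically_stable cost_integral by blast
qed

end
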